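(* Let $\mathcal{B}\subseteq\mathscr{B}(G)$ be a von Neumann algebra and let $\varphi:\mathcal{B}\to\mathcal{B}$ be a completely positive map such that $\beta(\mathrm{id},\varphi)<1$, where $\mathrm{id}$ is the identity map of $\mathcal{B}$ and $\beta$ is the Bures distance. Let $(E,x)$ be a GNS-construction for $\varphi$. Then $E\cong\mathcal{B}\oplus F$ (as von Neumann $\mathcal{B}$-$\mathcal{B}$-modules) for some von Neumann $\mathcal{B}$-$\mathcal{B}$-module $F$.
   Context: Inner products are linear in the second variable. For unital $C^*$-algebras $\mathcal{A},\mathcal{B}$, a Hilbert $\mathcal{A}$-$\mathcal{B}$-module is a Hilbert $\mathcal{B}$-module $E$ together with a unital $*$-homomorphism from $\mathcal{A}$ into the adjointable operators on $E$ (written as a left action $ax$). Let $\mathcal{B}\subseteq\mathscr{B}(G)$ be a von Neumann algebra on a Hilbert space $G$. For a Hilbert $\mathcal{B}$-module $E$, let $H=E\odot G$ be the completion of $E\otimes G$ modulo null vectors for $\langle x\otimes g,x'\otimes g'\rangle=\langle g,\langle x,x'\rangle g'\rangle$, and identify $x\in E$ with the operator $g\mapsto x\odot g$ in $\mathscr{B}(G,H)$. $E$ is a von Neumann $\mathcal{B}$-module if it is closed in $\mathscr{B}(G,H)$ in the strong operator topology; a von Neumann $\mathcal{A}$-$\mathcal{B}$-module is a Hilbert $\mathcal{A}$-$\mathcal{B}$-module that is a von Neumann $\mathcal{B}$-module (the left action need not be normal). $\mathcal{B}$ itself is a von Neumann $\mathcal{B}$-$\mathcal{B}$-module with $\langle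 b,b'\rangle=b^*b'$ and left and right multiplication as actions. Isomorphism means a bijective inner-product preserving map that is linear for both the left and the right actions. A GNS-construction for a CP map $\varphi:\mathcal{B}\to\mathcal{B}$ is a pair $(E,x)$ with $E$ a von Neumann $\mathcal{B}$-$\mathcal{B}$-module and $x\in E$ such that $\varphi(b)=\langle x,bx\rangle$ for all $b\in\mathcal{B}$ (no minimality required). Bures distance: for CP maps $\varphi_1,\varphi_2:\mathcal{A}\to\mathcal{B}$ and a Hilbert $\mathcal{A}$-$\mathcal{B}$-module $E$ let $S(E,\varphi_i)=\{x\in E:\varphi_i(a)=\langle x,ax\rangle\ \forall a\in\mathcal{A}\}$; $E$ is a common representation module if both $S(E,\varphi_1)$ and $S(E,\varphi_2)$ are nonempty. Then $\beta_E(\varphi_1,\varphi_2)=\inf\{\|x_1-x_2\|:x_i\in S(E,\varphi_i),\ i=1,2\}$ and $\beta(\varphi_1,\varphi_2)=\inf_E\beta_E(\varphi_1,\varphi_2)$ over all common representation modules $E$. (When $\mathcal{B}$ is a von Neumann algebra, restricting to common representation modules that are von Neumann $\mathcal{A}$-$\mathcal{B}$-modules gives the same value.) *)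

theory Defs
  imports "HOL-Analysis.Analysis"
begin

section \<open>Complex vector spaces and Hilbert spaces\<close>

class scaleC =
  fixes scaleC :: "complex \<Rightarrow> 'a \<Rightarrow> 'a"  (infixr \<open>*\<^sub>C\<close> 75)

class complex_vector = real_vector + scaleC +
  assumes scaleC_add_right: "c *\<^sub>C (x + y) = c *\<^sub>C x + c *\<^sub>C y"
    and scaleC_add_left: "(c + d) *\<^sub>C x = c *\<^sub>C x + d *\<^sub>C x"
    and scaleC_scaleC: "c *\<^sub>C d *\<^sub>C x = (c * d) *\<^sub>C x"
    and scaleC_one: "1 *\<^sub>C x = x"
    and scaleR_scaleC: "r *\<^sub>R x = complex_of_real r *\<^sub>C x"

class complex_normed_vector = complex_vector + real_normed_vector +
  assumes norm_scaleC: "norm (c *\<^sub>C x) = cmod c * norm x"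

text \<open>Inner products are linear in the second variable.  The last axiom says both that the inner
  product is positive definite and that the norm is the one it induces.\<close>

class complex_inner = complex_normed_vector +
  fixes cinner :: "'a \<Rightarrow> 'a \<Rightarrow> complex"
  assumes cinner_commute: "cinner x y = cnj (cinner y x)"
    and cinner_add_right: "cinner x (y + z) = cinner x y + cinner x z"
    and cinner_scaleC_right: "cinner x (c *\<^sub>C y) = c * cinner x y"
    and cinner_self: "cinner x x = complex_of_real ((norm x)\<^sup>2)"

class complex_hilbert_space = complex_inner + complete_space

instantiation complex :: complex_hilbert_space
begin

definition scaleC_complex :: "complex \<Rightarrow> complex \<Rightarrow> complex" where
  "scaleC_complex c x = c * x"

definition cinner_complex :: "complex \<Rightarrow> complex \<Rightarrow> complex" where
  "cinner_complex x y = cnj x * y"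

instance
  by standard
    (auto simp: scaleC_complex_def cinner_complex_def algebra_simps norm_mult scaleR_conv_of_real
      simp flip: complex_norm_square)

end

lemma bounded_linear_scaleC:
  "bounded_linear (\<lambda>x::'a::complex_normed_vector. c *\<^sub>C x)"
proof (rule bounded_linear_intro)
  show "c *\<^sub>C (r *\<^sub>R x) = r *\<^sub>R c *\<^sub>C x" for r and x :: 'a
    by (simp add: scaleR_scaleC scaleC_scaleC mult.commute)
  show "norm (c *\<^sub>C x) \<le> norm x * cmod c" for x :: 'a
    by (simp add: norm_scaleC mult.commute)
qed (rule scaleC_add_right)

instantiation blinfun :: (real_normed_vector, complex_normed_vector) complex_vector
begin

lift_definition scaleC_blinfun :: "complex \<Rightarrow> 'a \<Rightarrow>\<^sub>L 'b \<Rightarrow> 'a \<Rightarrow>\<^sub>L 'b"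
  is "\<lambda>c f x. c *\<^sub>C f x"
  by (rule bounded_linear_compose[OF bounded_linear_scaleC])

instance
  by standard
    (transfer; simp add: scaleC_add_right scaleC_add_left scaleC_scaleC scaleC_one scaleR_scaleC)+

end

instantiation prod :: (complex_vector, complex_vector) complex_vector
begin

definition scaleC_prod :: "complex \<Rightarrow> 'a \<times> 'b \<Rightarrow> 'a \<times> 'b" where
  "scaleC_prod c p = (c *\<^sub>C fst p, c *\<^sub>C snd p)"

instance
  by standard
    (auto simp: scaleC_prod_def prod_eq_iff scaleC_add_right scaleC_add_left scaleC_scaleC
      scaleC_one scaleR_scaleC)

end


section \<open>Operators and von Neumann algebras\<close>

text \<open>Elements of \<open>'g \<Rightarrow>\<^sub>L 'h\<close> are bounded and merely real linear, so complex linearity is a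
  separate predicate.\<close>

definition clinear_op :: "('g::complex_normed_vector \<Rightarrow>\<^sub>L 'h::complex_normed_vector) \<Rightarrow> bool" where
  "clinear_op T \<longleftrightarrow> (\<forall>c g. T (c *\<^sub>C g) = c *\<^sub>C T g)"

definition adj :: "('g::complex_inner \<Rightarrow>\<^sub>L 'h::complex_inner) \<Rightarrow> ('h \<Rightarrow>\<^sub>L 'g)" where
  "adj T = (THE S :: 'h \<Rightarrow>\<^sub>L 'g. \<forall>g h. cinner (T g) h = cinner g (S h))"

definition positive_op :: "('g::complex_inner \<Rightarrow>\<^sub>L 'g) \<Rightarrow> bool" where
  "positive_op T \<longleftrightarrow> (\<forall>g. cinner g (T g) \<in> \<real>\<^sub>\<ge>\<^sub>0)"

definition commutant :: "('g::complex_hilbert_space \<Rightarrow>\<^sub>L 'g) set \<Rightarrow> ('g \<Rightarrow>\<^sub>L 'g) set" where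
  "commutant M = {T. clinear_op T \<and> (\<forall>A\<in>M. T o\<^sub>L A = A o\<^sub>L T)}"

definition von_neumann_algebra :: "('g::complex_hilbert_space \<Rightarrow>\<^sub>L 'g) set \<Rightarrow> bool" where
  "von_neumann_algebra M \<longleftrightarrow>
     (\<forall>A\<in>M. clinear_op A) \<and> (\<forall>A\<in>M. adj A \<in> M) \<and> commutant (commutant M) = M"

text \<open>The operator matrix with entries \<open>b i j\<close> is positive on the \<open>n\<close>-fold direct sum of the
  Hilbert space.\<close>

definition positive_matrix :: "nat \<Rightarrow> (nat \<Rightarrow> nat \<Rightarrow> 'g::complex_inner \<Rightarrow>\<^sub>L 'g) \<Rightarrow> bool" where
  "positive_matrix n b \<longleftrightarrow> (\<forall>g. (\<Sum>i<n. \<Sum>j<n. cinner (g i) (b i j (g j))) \<in> \<real>\<^sub>\<ge>\<^sub>0)"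

definition completely_positive ::
  "('k::complex_inner \<Rightarrow>\<^sub>L 'k) set \<Rightarrow> ('g::complex_inner \<Rightarrow>\<^sub>L 'g) set
   \<Rightarrow> ('k \<Rightarrow>\<^sub>L 'k \<Rightarrow> 'g \<Rightarrow>\<^sub>L 'g) \<Rightarrow> bool" where
  "completely_positive A B \<phi> \<longleftrightarrow>
     (\<forall>a\<in>A. \<phi> a \<in> B) \<and>
     (\<forall>a\<in>A. \<forall>a'\<in>A. \<phi> (a + a') = \<phi> a + \<phi> a') \<and>
     (\<forall>c. \<forall>a\<in>A. \<phi> (c *\<^sub>C a) = c *\<^sub>C \<phi> a) \<and>
     (\<forall>n a. (\<forall>i<n. \<forall>j<n. a i j \<in> A) \<and> positive_matrix n a
        \<longrightarrow> positive_matrix n (\<lambda>i j. \<phi> (a i j)))"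


section \<open>Hilbert modules\<close>

text \<open>The vector space underlying a module is a complex subspace \<open>carrier E\<close> of an ambient
  complex vector space \<open>'e\<close>.  The values of the operations outside the carrier and
  outside the algebras are irrelevant.\<close>

record ('e, 'a, 'b) bimodule =
  carrier :: "'e set"
  lact :: "'a \<Rightarrow> 'e \<Rightarrow> 'e"
  ract :: "'e \<Rightarrow> 'b \<Rightarrow> 'e"
  ip :: "'e \<Rightarrow> 'e \<Rightarrow> 'b"

definition mod_norm ::
  "('e, 'a, 'g::complex_hilbert_space \<Rightarrow>\<^sub>L 'g) bimodule \<Rightarrow> 'e \<Rightarrow> real" where
  "mod_norm E x = sqrt (norm (ip E x x))"

text \<open>Hilbert modules over a unital algebra \<open>B\<close> of operators; the left action plays no role here.\<close>

locale hilbert_module =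
  fixes B :: "('g::complex_hilbert_space \<Rightarrow>\<^sub>L 'g) set"
    and E :: "('e::complex_vector, 'a, 'g \<Rightarrow>\<^sub>L 'g) bimodule"
  assumes zero_closed: "0 \<in> carrier E"
    and add_closed: "\<lbrakk>x \<in> carrier E; y \<in> carrier E\<rbrakk> \<Longrightarrow> x + y \<in> carrier E"
    and scaleC_closed: "x \<in> carrier E \<Longrightarrow> c *\<^sub>C x \<in> carrier E"
    and ract_closed: "\<lbrakk>x \<in> carrier E; b \<in> B\<rbrakk> \<Longrightarrow> ract E x b \<in> carrier E"
    and ract_add_left: "\<lbrakk>x \<in> carrier E; y \<in> carrier E; b \<in> B\<rbrakk>
      \<Longrightarrow> ract E (x + y) b = ract E x b + ract E y b"
    and ract_add_right: "\<lbrakk>x \<in> carrier E; b \<in> B; b' \<in> B\<rbrakk>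
      \<Longrightarrow> ract E x (b + b') = ract E x b + ract E x b'"
    and ract_scaleC_left: "\<lbrakk>x \<in> carrier E; b \<in> B\<rbrakk> \<Longrightarrow> ract E (c *\<^sub>C x) b = c *\<^sub>C ract E x b"
    and ract_scaleC_right: "\<lbrakk>x \<in> carrier E; b \<in> B\<rbrakk> \<Longrightarrow> ract E x (c *\<^sub>C b) = c *\<^sub>C ract E x b"
    and ract_compose: "\<lbrakk>x \<in> carrier E; b \<in> B; b' \<in> B\<rbrakk>
      \<Longrightarrow> ract E x (b o\<^sub>L b') = ract E (ract E x b) b'"
    and ract_one: "x \<in> carrier E \<Longrightarrow> ract E x id_blinfun = x"
    and ip_closed: "\<lbrakk>x \<in> carrier E; y \<in> carrier E\<rbrakk> \<Longrightarrow> ip E x y \<in> B"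
    and ip_add_right: "\<lbrakk>x \<in> carrier E; y \<in> carrier E; z \<in> carrier E\<rbrakk>
      \<Longrightarrow> ip E x (y + z) = ip E x y + ip E x z"
    and ip_scaleC_right: "\<lbrakk>x \<in> carrier E; y \<in> carrier E\<rbrakk> \<Longrightarrow> ip E x (c *\<^sub>C y) = c *\<^sub>C ip E x y"
    and ip_ract_right: "\<lbrakk>x \<in> carrier E; y \<in> carrier E; b \<in> B\<rbrakk>
      \<Longrightarrow> ip E x (ract E y b) = ip E x y o\<^sub>L b"
    and ip_adj: "\<lbrakk>x \<in> carrier E; y \<in> carrier E\<rbrakk> \<Longrightarrow> ip E x y = adj (ip E y x)"
    and ip_positive: "x \<in> carrier E \<Longrightarrow> positive_op (ip E x x)"
    and ip_definite: "\<lbrakk>x \<in> carrier E; ip E x x = 0\<rbrakk> \<Longrightarrow> x = 0"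
    and complete: "\<lbrakk>\<And>n. s n \<in> carrier E;
        \<forall>e>0. \<exists>N. \<forall>m\<ge>N. \<forall>n\<ge>N. mod_norm E (s m - s n) < e\<rbrakk>
      \<Longrightarrow> \<exists>x\<in>carrier E. (\<lambda>n. mod_norm E (s n - x)) \<longlonglongrightarrow> 0"

text \<open>\<open>lact_adj\<close> says that the action of \<open>a\<close> is an adjointable operator whose adjoint is
  the action of \<open>adj a\<close>.  Adjointable operators are automatically bounded and right linear.\<close>

locale hilbert_bimodule = hilbert_module B E
  for A :: "('k::complex_hilbert_space \<Rightarrow>\<^sub>L 'k) set"
    and B :: "('g::complex_hilbert_space \<Rightarrow>\<^sub>L 'g) set"
    and E :: "('e::complex_vector, 'k \<Rightarrow>\<^sub>L 'k, 'g \<Rightarrow>\<^sub>L 'g) bimodule" +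
  assumes lact_closed: "\<lbrakk>a \<in> A; x \<in> carrier E\<rbrakk> \<Longrightarrow> lact E a x \<in> carrier E"
    and lact_adj: "\<lbrakk>a \<in> A; x \<in> carrier E; y \<in> carrier E\<rbrakk>
      \<Longrightarrow> ip E (lact E a x) y = ip E x (lact E (adj a) y)"
    and lact_add: "\<lbrakk>a \<in> A; a' \<in> A; x \<in> carrier E\<rbrakk>
      \<Longrightarrow> lact E (a + a') x = lact E a x + lact E a' x"
    and lact_scaleC: "\<lbrakk>a \<in> A; x \<in> carrier E\<rbrakk> \<Longrightarrow> lact E (c *\<^sub>C a) x = c *\<^sub>C lact E a x"
    and lact_compose: "\<lbrakk>a \<in> A; a' \<in> A; x \<in> carrier E\<rbrakk>
      \<Longrightarrow> lact E (a o\<^sub>L a') x = lact E a (lact E a' x)"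
    and lact_one: "x \<in> carrier E \<Longrightarrow> lact E id_blinfun x = x"


section \<open>Von Neumann modules\<close>

text \<open>Let \<open>L x g\<close> stand for the vector \<open>x \<odot> g\<close>.  If \<open>tensor_embedding E L\<close> holds,
  then \<open>x \<otimes> g \<mapsto> L x g\<close> preserves the semi-inner product of the algebraic tensor
  product (in particular it is bilinear on \<open>carrier E\<close>), so the closed subspace
  \<open>tensor_space E L\<close> is the completion of the tensor product modulo null vectors, which is unique
  up to a canonical unitary.  The real span suffices because the set of vectors
  \<open>L x g\<close> is invariant under complex scalars.\<close>

definition tensor_embedding ::
  "('e, 'a, 'g::complex_hilbert_space \<Rightarrow>\<^sub>L 'g) bimodule
   \<Rightarrow> ('e \<Rightarrow> 'g \<Rightarrow>\<^sub>L 'h::complex_hilbert_space) \<Rightarrow> bool" where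
  "tensor_embedding E L \<longleftrightarrow>
     (\<forall>x\<in>carrier E. \<forall>x'\<in>carrier E. \<forall>g g'.
        cinner (L x g) (L x' g') = cinner g (ip E x x' g'))"

definition tensor_space ::
  "('e, 'a, 'g::complex_hilbert_space \<Rightarrow>\<^sub>L 'g) bimodule
   \<Rightarrow> ('e \<Rightarrow> 'g \<Rightarrow>\<^sub>L 'h::complex_hilbert_space) \<Rightarrow> 'h set" where
  "tensor_space E L = closure (span {L x g | x g. x \<in> carrier E})"

definition ops_into :: "'h set \<Rightarrow> ('g::complex_hilbert_space \<Rightarrow>\<^sub>L 'h::complex_hilbert_space) set" where
  "ops_into H = {T. clinear_op T \<and> range T \<subseteq> H}"

text \<open>The type \<open>'h\<close> is any Hilbert space large enough to contain the tensor product of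
  the module with \<open>'g\<close>.  For a given module the closedness condition depends neither on
  \<open>'h\<close> nor on \<open>L\<close>.\<close>

definition von_neumann_module ::
  "'h::complex_hilbert_space itself \<Rightarrow> ('g::complex_hilbert_space \<Rightarrow>\<^sub>L 'g) set
   \<Rightarrow> ('e::complex_vector, 'a, 'g \<Rightarrow>\<^sub>L 'g) bimodule \<Rightarrow> bool" where
  "von_neumann_module (_ :: 'h itself) B E \<longleftrightarrow>
     hilbert_module B E \<and>
     (\<exists>L :: 'e \<Rightarrow> 'g \<Rightarrow>\<^sub>L 'h. tensor_embedding E L \<and>
        closedin (subtopology strong_operator_topology (ops_into (tensor_space E L)))
          (L ` carrier E))"

definition von_neumann_bimodule ::
  "'h::complex_hilbert_space itself \<Rightarrow> ('k::complex_hilbert_space \<Rightarrow>\<^sub>L 'k) set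
   \<Rightarrow> ('g::complex_hilbert_space \<Rightarrow>\<^sub>L 'g) set
   \<Rightarrow> ('e::complex_vector, 'k \<Rightarrow>\<^sub>L 'k, 'g \<Rightarrow>\<^sub>L 'g) bimodule \<Rightarrow> bool" where
  "von_neumann_bimodule H A B E \<longleftrightarrow> hilbert_bimodule A B E \<and> von_neumann_module H B E"

definition self_bimodule ::
  "('g::complex_hilbert_space \<Rightarrow>\<^sub>L 'g) set \<Rightarrow> ('g \<Rightarrow>\<^sub>L 'g, 'g \<Rightarrow>\<^sub>L 'g, 'g \<Rightarrow>\<^sub>L 'g) bimodule" where
  "self_bimodule B =
     \<lparr>carrier = B, lact = (o\<^sub>L), ract = (o\<^sub>L), ip = (\<lambda>b b'. adj b o\<^sub>L b')\<rparr>"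

definition direct_sum ::
  "('e, 'a, 'b::plus) bimodule \<Rightarrow> ('f, 'a, 'b) bimodule \<Rightarrow> ('e \<times> 'f, 'a, 'b) bimodule" where
  "direct_sum E F =
     \<lparr>carrier = carrier E \<times> carrier F,
      lact = (\<lambda>a (x, y). (lact E a x, lact F a y)),
      ract = (\<lambda>(x, y) b. (ract E x b, ract F y b)),
      ip = (\<lambda>(x, y) (x', y'). ip E x x' + ip F y y')\<rparr>"

definition bimodule_iso ::
  "'a set \<Rightarrow> 'b set \<Rightarrow> ('e::complex_vector, 'a, 'b) bimodule
   \<Rightarrow> ('f::complex_vector, 'a, 'b) bimodule \<Rightarrow> ('e \<Rightarrow> 'f) \<Rightarrow> bool" where
  "bimodule_iso A B E F u \<longleftrightarrow>
     bij_betw u (carrier E) (carrier F) \<and>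
     (\<forall>x\<in>carrier E. \<forall>y\<in>carrier E. ip F (u x) (u y) = ip E x y) \<and>
     (\<forall>x\<in>carrier E. \<forall>y\<in>carrier E. u (x + y) = u x + u y) \<and>
     (\<forall>c. \<forall>x\<in>carrier E. u (c *\<^sub>C x) = c *\<^sub>C u x) \<and>
     (\<forall>a\<in>A. \<forall>x\<in>carrier E. u (lact E a x) = lact F a (u x)) \<and>
     (\<forall>b\<in>B. \<forall>x\<in>carrier E. u (ract E x b) = ract F (u x) b)"

definition isomorphic ::
  "'a set \<Rightarrow> 'b set \<Rightarrow> ('e::complex_vector, 'a, 'b) bimodule
   \<Rightarrow> ('f::complex_vector, 'a, 'b) bimodule \<Rightarrow> bool" where
  "isomorphic A B E F \<longleftrightarrow> (\<exists>u. bimodule_iso A B E F u)"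


section \<open>GNS-constructions and the Bures distance\<close>

definition S_set :: "'a set \<Rightarrow> ('e, 'a, 'b) bimodule \<Rightarrow> ('a \<Rightarrow> 'b) \<Rightarrow> 'e set" where
  "S_set A E \<phi> = {x \<in> carrier E. \<forall>a\<in>A. \<phi> a = ip E x (lact E a x)}"

definition gns_construction ::
  "'h::complex_hilbert_space itself \<Rightarrow> ('g::complex_hilbert_space \<Rightarrow>\<^sub>L 'g) set
   \<Rightarrow> ('g \<Rightarrow>\<^sub>L 'g \<Rightarrow> 'g \<Rightarrow>\<^sub>L 'g)
   \<Rightarrow> ('e::complex_vector, 'g \<Rightarrow>\<^sub>L 'g, 'g \<Rightarrow>\<^sub>L 'g) bimodule \<Rightarrow> 'e \<Rightarrow> bool" where
  "gns_construction H B \<phi> E x \<longleftrightarrow>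
     von_neumann_bimodule H B B E \<and> x \<in> carrier E \<and> (\<forall>b\<in>B. \<phi> b = ip E x (lact E b x))"

definition common_rep_module ::
  "('k::complex_hilbert_space \<Rightarrow>\<^sub>L 'k) set \<Rightarrow> ('g::complex_hilbert_space \<Rightarrow>\<^sub>L 'g) set
   \<Rightarrow> ('e::complex_vector, 'k \<Rightarrow>\<^sub>L 'k, 'g \<Rightarrow>\<^sub>L 'g) bimodule
   \<Rightarrow> ('k \<Rightarrow>\<^sub>L 'k \<Rightarrow> 'g \<Rightarrow>\<^sub>L 'g) \<Rightarrow> ('k \<Rightarrow>\<^sub>L 'k \<Rightarrow> 'g \<Rightarrow>\<^sub>L 'g) \<Rightarrow> bool" where
  "common_rep_module A B E \<phi>\<^sub>1 \<phi>\<^sub>2 \<longleftrightarrow>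
     hilbert_bimodule A B E \<and> S_set A E \<phi>\<^sub>1 \<noteq> {} \<and> S_set A E \<phi>\<^sub>2 \<noteq> {}"

definition bures_distance_on ::
  "('k::complex_hilbert_space \<Rightarrow>\<^sub>L 'k) set
   \<Rightarrow> ('e::complex_vector, 'k \<Rightarrow>\<^sub>L 'k, 'g::complex_hilbert_space \<Rightarrow>\<^sub>L 'g) bimodule
   \<Rightarrow> ('k \<Rightarrow>\<^sub>L 'k \<Rightarrow> 'g \<Rightarrow>\<^sub>L 'g) \<Rightarrow> ('k \<Rightarrow>\<^sub>L 'k \<Rightarrow> 'g \<Rightarrow>\<^sub>L 'g) \<Rightarrow> ereal" where
  "bures_distance_on A E \<phi>\<^sub>1 \<phi>\<^sub>2 =
     (INF (x\<^sub>1, x\<^sub>2) \<in> S_set A E \<phi>\<^sub>1 \<times> S_set A E \<phi>\<^sub>2. ereal (mod_norm E (x\<^sub>1 - x\<^sub>2)))"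

text \<open>The infimum over all common representation modules with ambient vector space \<open>'m\<close>; a
  distance less than \<open>1\<close> in the sense of all modules means that it is less than
  \<open>1\<close> for some type \<open>'m\<close>.  The value is \<open>\<infinity>\<close> if \<open>'m\<close> is too small to
  carry a common representation module.\<close>

definition bures_distance ::
  "'m::complex_vector itself \<Rightarrow> ('k::complex_hilbert_space \<Rightarrow>\<^sub>L 'k) set
   \<Rightarrow> ('g::complex_hilbert_space \<Rightarrow>\<^sub>L 'g) set
   \<Rightarrow> ('k \<Rightarrow>\<^sub>L 'k \<Rightarrow> 'g \<Rightarrow>\<^sub>L 'g) \<Rightarrow> ('k \<Rightarrow>\<^sub>L 'k \<Rightarrow> 'g \<Rightarrow>\<^sub>L 'g) \<Rightarrow> ereal" where
  "bures_distance (_ :: 'm itself) A B \<phi>\<^sub>1 \<phi>\<^sub>2 =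
     (INF E \<in> {E :: ('m, 'k \<Rightarrow>\<^sub>L 'k, 'g \<Rightarrow>\<^sub>L 'g) bimodule. common_rep_module A B E \<phi>\<^sub>1 \<phi>\<^sub>2}.
        bures_distance_on A E \<phi>\<^sub>1 \<phi>\<^sub>2)"

end

theory Submission
  imports Defs
begin

text \<open>Let \<open>x\<^sub>1\<close>, \<open>x\<^sub>2\<close> represent \<open>id\<close> and \<open>\<phi>\<close> in a common module with \<open>\<parallel>x\<^sub>1 - x\<^sub>2\<parallel> < 1\<close>.  Then \<open>x\<^sub>1\<close> commutes
  with \<open>B\<close>, so \<open>\<langle>x\<^sub>1, a x\<^sub>2\<rangle> = a c\<close> with \<open>c = \<langle>x\<^sub>1, x\<^sub>2\<rangle>\<close> and \<open>\<parallel>1 - c\<parallel> < 1\<close>, and \<open>\<phi>\<close> dominates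
  \<open>b \<mapsto> c\<^sup>* b c\<close>.  By this domination and the strong closedness of \<open>E\<close> there is \<open>z \<in> E\<close> with
  \<open>\<langle>z, a x\<rangle> = a c\<close> for all \<open>a\<close>, and \<open>z\<close> commutes with \<open>B\<close>.  Since \<open>c\<close> is bounded below, the central
  element \<open>\<langle>z, z\<rangle>\<close> is invertible; then \<open>y = z \<langle>z, z\<rangle>\<^sup>-\<^sup>1\<^sup>/\<^sup>2\<close> is central with \<open>\<langle>y, y\<rangle> = 1\<close>, so
  \<open>E = y B \<oplus> F\<close> where \<open>F\<close> is the orthogonal complement of \<open>y\<close>.\<close>

section \<open>Complex inner products\<close>

text \<open>The vectors supplied by the distance live in a module that need have no relation to
  \<open>E\<close> and is only a Hilbert module. Hence no vector is carried over, only an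
  inequality. The vectors \<open>a x\<^sub>2 - x\<^sub>1 a c\<close> are orthogonal to
  \<open>x\<^sub>1\<close>, and positivity of their Gram matrices is the domination; its larger side
  depends on \<phi> alone, so \<open>x\<^sub>2\<close> may be replaced by \<open>x\<close>. The
  bound 1 on the distance enters once: since \<open>x\<^sub>1\<close> has inner square 1, the
  element 1 - c is the inner product of \<open>x\<^sub>1\<close> with
  \<open>x\<^sub>1 - x\<^sub>2\<close> and has norm below 1. So Re <c g, g> is at least a positive
  multiple of the squared norm of g, and <c g, g> = <x g, z g> bounds z g from below. Normalising
  \<open>z\<close> is harmless because <z, z> lies in the centre: multiplication by its inverse
  square root preserves commutation with \<open>B\<close>. In place of self-duality of von Neumann
  modules, strong closedness is used directly: strong neighbourhoods test only finitely many
  vectors, so membership in \<open>E\<close> is decided by a projection in a finite direct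
  sum.\<close>

instance complex_hilbert_space \<subseteq> banach ..

lemma scaleC_zero_left [simp]: "0 *\<^sub>C (x::'a::complex_vector) = 0"
  using scaleR_scaleC[of 0 x] by simp

lemma scaleC_zero_right [simp]: "c *\<^sub>C (0::'a::complex_vector) = 0"
  using scaleC_scaleC[of c 0 "0::'a"] by simp

lemma scaleC_diff_right: "c *\<^sub>C (x - y) = c *\<^sub>C x - c *\<^sub>C (y::'a::complex_vector)"
  using scaleC_add_right[of c "x - y" y] by simp

lemma scaleC_minus1: "(-1) *\<^sub>C (x::'a::complex_vector) = - x"
  using scaleR_scaleC[of "-1" x] by simp

lemma blinfun_scaleC_apply [simp]: "blinfun_apply (c *\<^sub>C T) g = c *\<^sub>C blinfun_apply T g"
  by transfer simp

lemma cinner_zero_right [simp]: "cinner (x::'a::complex_inner) 0 = 0"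
  using cinner_scaleC_right[of x 0 0] by simp

lemma cinner_zero_left [simp]: "cinner 0 (x::'a::complex_inner) = 0"
  by (subst cinner_commute) simp

lemma cinner_add_left: "cinner (x + y) (z::'a::complex_inner) = cinner x z + cinner y z"
  by (subst (1 2 3) cinner_commute) (simp add: cinner_add_right)

lemma cinner_scaleC_left: "cinner (c *\<^sub>C x) (z::'a::complex_inner) = cnj c * cinner x z"
  by (subst (1 2) cinner_commute) (simp add: cinner_scaleC_right)

lemma cinner_minus_right: "cinner (x::'a::complex_inner) (- y) = - cinner x y"
  using cinner_scaleC_right[of x "-1" y] by (simp add: scaleC_minus1)

lemma cinner_minus_left: "cinner (- x) (y::'a::complex_inner) = - cinner x y"
  using cinner_scaleC_left[of "-1" x y] by (simp add: scaleC_minus1)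

lemma cinner_diff_right: "cinner (x::'a::complex_inner) (y - z) = cinner x y - cinner x z"
  using cinner_add_right[of x y "-z"] by (simp add: cinner_minus_right)

lemma cinner_diff_left: "cinner (x - y) (z::'a::complex_inner) = cinner x z - cinner y z"
  using cinner_add_left[of x "-y" z] by (simp add: cinner_minus_left)

lemma cinner_eq_zero_iff [simp]: "cinner x x = 0 \<longleftrightarrow> (x::'a::complex_inner) = 0"
  by (simp add: cinner_self)

lemma Re_cinner_self: "Re (cinner x x) = (norm (x::'a::complex_inner))\<^sup>2"
  by (simp add: cinner_self)

lemma norm_add_sq:
  "(norm (x + y :: 'a::complex_inner))\<^sup>2 = (norm x)\<^sup>2 + 2 * Re (cinner x y) + (norm y)\<^sup>2"
proof -
  have "Re (cinner y x) = Re (cinner x y)" by (subst cinner_commute) simp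
  then show ?thesis
    by (simp add: cinner_add_right cinner_add_left flip: Re_cinner_self)
qed

lemma cinner_Cauchy_Schwarz: "cmod (cinner x y) \<le> norm x * norm (y::'a::complex_inner)"
proof (cases "y = 0")
  case False
  define n where "n = (norm y)\<^sup>2"
  define c where "c = cinner y x / complex_of_real n"
  have n: "n > 0" using False by (simp add: n_def)
  have "0 \<le> Re (cinner (x - c *\<^sub>C y) (x - c *\<^sub>C y))" by (simp add: Re_cinner_self)
  also have "cinner (x - c *\<^sub>C y) (x - c *\<^sub>C y)
      = cinner x x - c * cinner x y - cnj c * cinner y x + cnj c * c * cinner y y"
    by (simp add: cinner_diff_right cinner_diff_left cinner_scaleC_right cinner_scaleC_left
        algebra_simps)
  also have "cnj c * c * cinner y y = cnj c * cinner y x"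
    unfolding cinner_self c_def n_def[symmetric] using n by simp
  also have "c * cinner x y = complex_of_real ((cmod (cinner x y))\<^sup>2 / n)"
    unfolding of_real_divide complex_norm_square c_def cinner_commute[of y x] by simp
  finally have "(cmod (cinner x y))\<^sup>2 / n \<le> (norm x)\<^sup>2"
    by (simp add: cinner_self)
  then have "(cmod (cinner x y))\<^sup>2 \<le> (norm x * norm y)\<^sup>2"
    using n by (simp add: field_simps power_mult_distrib n_def)
  then show ?thesis by (rule power2_le_imp_le) simp
qed simp

lemma bounded_bilinear_cinner:
  "bounded_bilinear (cinner :: 'a::complex_inner \<Rightarrow> 'a \<Rightarrow> complex)"
proof
  show "\<exists>K. \<forall>a b :: 'a. norm (cinner a b) \<le> norm a * norm b * K"
    by (rule exI[of _ 1]) (simp add: cinner_Cauchy_Schwarz)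
qed (simp_all add: cinner_add_left cinner_add_right scaleR_scaleC cinner_scaleC_left
    cinner_scaleC_right scaleC_complex_def)

lemmas tendsto_cinner [tendsto_intros] =
  bounded_bilinear.tendsto[OF bounded_bilinear_cinner]
lemmas cinner_sum_left = bounded_bilinear.sum_left[OF bounded_bilinear_cinner]
lemmas cinner_sum_right = bounded_bilinear.sum_right[OF bounded_bilinear_cinner]
lemmas continuous_on_cinner [continuous_intros] =
  bounded_bilinear.continuous_on[OF bounded_bilinear_cinner]

lemma cinner_ext:
  assumes "\<And>z. cinner z x = cinner z (y::'a::complex_inner)" shows "x = y"
proof -
  have "cinner (x - y) (x - y) = 0" by (simp add: cinner_diff_right assms)
  then show ?thesis by simp
qed

lemma norm_le_if_cinner_le:
  assumes "\<And>z. cmod (cinner z x) \<le> K * norm z" "K \<ge> 0"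
  shows "norm (x::'a::complex_inner) \<le> K"
proof (cases "x = 0")
  case False
  have "norm x * norm x \<le> K * norm x"
    using assms(1)[of x] by (simp add: cinner_self power2_eq_square norm_mult)
  with False show ?thesis by simp
qed (use assms in simp)

text \<open>A bounded functional \<open>\<alpha>\<close> on a subspace \<open>S\<close>, seminormed by the finitely many linear maps
  \<open>N i\<close>, is represented by a minimiser of \<open>\<Sum>i. (norm (N i v))\<^sup>2 - 2 * Re (\<alpha> v)\<close>.\<close>

lemma riesz_family:
  fixes S :: "'v::complex_vector set" and N :: "'i \<Rightarrow> 'v \<Rightarrow> 'h::complex_hilbert_space"
    and \<alpha> :: "'v \<Rightarrow> complex"
  assumes "0 \<in> S"
    and S_add: "\<And>u v. u \<in> S \<Longrightarrow> v \<in> S \<Longrightarrow> u + v \<in> S"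
    and S_scale: "\<And>c u. u \<in> S \<Longrightarrow> c *\<^sub>C u \<in> S"
    and N_add: "\<And>i u v. i \<in> I \<Longrightarrow> u \<in> S \<Longrightarrow> v \<in> S \<Longrightarrow> N i (u + v) = N i u + N i v"
    and N_scale: "\<And>i c u. i \<in> I \<Longrightarrow> u \<in> S \<Longrightarrow> N i (c *\<^sub>C u) = c *\<^sub>C N i u"
    and \<alpha>_add: "\<And>u v. u \<in> S \<Longrightarrow> v \<in> S \<Longrightarrow> \<alpha> (u + v) = \<alpha> u + \<alpha> v"
    and \<alpha>_scale: "\<And>c u. u \<in> S \<Longrightarrow> \<alpha> (c *\<^sub>C u) = c * \<alpha> u"
    and I: "finite I"
    and bound: "\<And>v. v \<in> S \<Longrightarrow> (cmod (\<alpha> v))\<^sup>2 \<le> K * (\<Sum>i\<in>I. (norm (N i v))\<^sup>2)"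
  obtains q s where "\<And>n. s n \<in> S" "\<And>i. i \<in> I \<Longrightarrow> (\<lambda>n::nat. N i (s n)) \<longlonglongrightarrow> q i"
    "\<And>v. v \<in> S \<Longrightarrow> (\<Sum>i\<in>I. cinner (q i) (N i v)) = \<alpha> v"
proof -
  define A where "A v = (\<Sum>i\<in>I. (norm (N i v))\<^sup>2)" for v
  define J where "J v = A v - 2 * Re (\<alpha> v)" for v
  define C where "C u v = (\<Sum>i\<in>I. Re (cinner (N i u) (N i v)))" for u v
  have A0: "A v \<ge> 0" for v by (simp add: A_def sum_nonneg)
  have S_scaleR: "r *\<^sub>R u \<in> S" if "u \<in> S" for r u using S_scale[OF that] by (simp add: scaleR_scaleC)
  have N_scaleR: "N i (r *\<^sub>R u) = r *\<^sub>R N i u" if "i \<in> I" "u \<in> S" for i r u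
    using N_scale[OF that] by (simp add: scaleR_scaleC)
  have \<alpha>_scaleR: "\<alpha> (r *\<^sub>R u) = of_real r * \<alpha> u" if "u \<in> S" for r u
    using \<alpha>_scale[OF that] by (simp add: scaleR_scaleC)
  \<comment> \<open>By the arithmetic-geometric mean inequality, \<open>2 * Re (\<alpha> v)\<close>
    is at most \<open>A v + \<bar>K\<bar>\<close>, which leaves the lower bound
    \<open>- \<bar>K\<bar>\<close> for \<open>J v\<close>.\<close>
  have J_lower: "J v \<ge> - \<bar>K\<bar>" if v: "v \<in> S" for v
  proof -
    have "(Re (\<alpha> v))\<^sup>2 \<le> (cmod (\<alpha> v))\<^sup>2"
      using abs_Re_le_cmod[of "\<alpha> v"] by (metis abs_le_square_iff abs_norm_cancel)
    also have "\<dots> \<le> K * A v" using bound[OF v] by (simp add: A_def)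
    also have "\<dots> \<le> \<bar>K\<bar> * A v" using A0[of v] by (simp add: mult_right_mono)
    also have "\<dots> \<le> ((A v + \<bar>K\<bar>) / 2)\<^sup>2"
      using zero_le_power2[of "A v - \<bar>K\<bar>"] by (simp add: power2_eq_square field_simps)
    finally have "\<bar>Re (\<alpha> v)\<bar> \<le> \<bar>(A v + \<bar>K\<bar>) / 2\<bar>" by (simp only: abs_le_square_iff)
    then show ?thesis using A0[of v] by (simp add: J_def abs_le_iff)
  qed
  have J_expand: "J (u + t *\<^sub>R v) = J u + t * (2 * C u v - 2 * Re (\<alpha> v)) + t\<^sup>2 * A v"
    if "u \<in> S" "v \<in> S" for u v t
  proof -
    have "A (u + t *\<^sub>R v) = (\<Sum>i\<in>I. (norm (N i u))\<^sup>2 + t * (2 * Re (cinner (N i u) (N i v)))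
        + t\<^sup>2 * (norm (N i v))\<^sup>2)"
      unfolding A_def
      by (intro sum.cong refl)
        (simp add: N_add N_scaleR S_scaleR that norm_add_sq power_mult_distrib
          bounded_bilinear.scaleR_right[OF bounded_bilinear_cinner])
    also have "\<dots> = A u + t * (2 * C u v) + t\<^sup>2 * A v"
      by (simp add: A_def C_def sum.distrib sum_distrib_left)
    finally show ?thesis
      by (simp add: J_def \<alpha>_add \<alpha>_scaleR S_scaleR that algebra_simps)
  qed
  define m where "m = Inf (J ` S)"
  have bdd: "bdd_below (J ` S)" using J_lower by (rule bdd_belowI2)
  have m_le: "m \<le> J v" if "v \<in> S" for v
    unfolding m_def using bdd that by (rule cINF_lower)
  have "\<exists>v\<in>S. J v < m + inverse (real (Suc n))" for n
    using cInf_lessD[of "J ` S" "m + inverse (real (Suc n))"] \<open>0 \<in> S\<close> by (auto simp: m_def)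
  then obtain s where sS: "\<And>n. s n \<in> S" and sJ: "\<And>n. J (s n) < m + inverse (real (Suc n))"
    by metis
  have J_lim: "(\<lambda>n. J (s n)) \<longlonglongrightarrow> m"
  proof (rule real_tendsto_sandwich)
    show "(\<lambda>n. m) \<longlonglongrightarrow> m" by simp
    show "(\<lambda>n. m + inverse (real (Suc n))) \<longlonglongrightarrow> m"
      using tendsto_add[OF tendsto_const[of m] LIMSEQ_inverse_real_of_nat] by simp
  qed (use sJ m_le[OF sS] in \<open>auto intro!: always_eventually less_imp_le\<close>)
  \<comment> \<open>Comparing \<open>m\<close> with \<open>J\<close> at the midpoint of
    \<open>u\<close> and \<open>v\<close> bounds \<open>A (u - v)\<close>. This makes
    \<open>N i\<close> of a minimising sequence Cauchy, although \<open>S\<close> itself carries no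
    norm.\<close>
  have par: "(norm (N i u - N i v))\<^sup>2 \<le> 2 * (J u - m) + 2 * (J v - m)"
    if i: "i \<in> I" and u: "u \<in> S" and v: "v \<in> S" for i u v
  proof -
    have d: "u + (-1) *\<^sub>R v \<in> S" using S_add[OF u S_scaleR[OF v]] .
    have e: "J v = J (u + (-1) *\<^sub>R (u + (-1) *\<^sub>R v))" by simp
    have h: "m \<le> J (u + (-1/2) *\<^sub>R (u + (-1) *\<^sub>R v))"
      by (rule m_le[OF S_add[OF u S_scaleR[OF d]]])
    have "(norm (N i u - N i v))\<^sup>2 = (norm (N i (u + (-1) *\<^sub>R v)))\<^sup>2"
      using N_add[OF i u S_scaleR[OF v, of "-1"]] N_scaleR[OF i v, of "-1"] by simp
    also have "\<dots> \<le> A (u + (-1) *\<^sub>R v)"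
      unfolding A_def using member_le_sum[of i I "\<lambda>i. (norm (N i (u + (-1) *\<^sub>R v)))\<^sup>2"] i I by simp
    finally show ?thesis
      using h e unfolding J_expand[OF u d] by (simp add: power2_eq_square field_simps)
  qed
  have "Cauchy (\<lambda>n. N i (s n))" if i: "i \<in> I" for i
  proof (rule CauchyI)
    fix e :: real assume e: "e > 0"
    then have "\<forall>\<^sub>F n in sequentially. J (s n) < m + e\<^sup>2 / 4"
      using order_tendstoD(2)[OF J_lim, of "m + e\<^sup>2 / 4"] by simp
    then obtain M where M: "\<And>n. n \<ge> M \<Longrightarrow> J (s n) < m + e\<^sup>2 / 4"
      by (auto simp: eventually_sequentially)
    show "\<exists>M. \<forall>k\<ge>M. \<forall>n\<ge>M. norm (N i (s k) - N i (s n)) < e"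
    proof (intro exI allI impI)
      fix k n assume "k \<ge> M" "n \<ge> M"
      then have "(norm (N i (s k) - N i (s n)))\<^sup>2 < e\<^sup>2"
        using par[OF i sS[of k] sS[of n]] M[of k] M[of n] by simp
      then show "norm (N i (s k) - N i (s n)) < e" using e by (simp add: power2_less_imp_less)
    qed
  qed
  then have "\<forall>i\<in>I. \<exists>q. (\<lambda>n. N i (s n)) \<longlonglongrightarrow> q"
    by (simp add: Cauchy_convergent_iff convergent_def)
  then obtain q where q: "\<And>i. i \<in> I \<Longrightarrow> (\<lambda>n. N i (s n)) \<longlonglongrightarrow> q i" by metis
  \<comment> \<open>First variation at the infimum: a perturbation \<open>t v\<close> cannot lower
    the limit, so the part linear in \<open>t\<close> must vanish.\<close>
  have Re_eq: "Re (\<Sum>i\<in>I. cinner (q i) (N i v)) = Re (\<alpha> v)" if v: "v \<in> S" for v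
  proof -
    define b where "b = (\<Sum>i\<in>I. Re (cinner (q i) (N i v))) - Re (\<alpha> v)"
    have ineq: "0 \<le> t * (2 * b) + t\<^sup>2 * A v" for t
    proof -
      have "(\<lambda>n. J (s n) + t * (2 * C (s n) v - 2 * Re (\<alpha> v)) + t\<^sup>2 * A v)
          \<longlonglongrightarrow> m + t * (2 * (\<Sum>i\<in>I. Re (cinner (q i) (N i v))) - 2 * Re (\<alpha> v)) + t\<^sup>2 * A v"
        unfolding C_def by (intro tendsto_intros J_lim q)
      moreover have "m \<le> J (s n) + t * (2 * C (s n) v - 2 * Re (\<alpha> v)) + t\<^sup>2 * A v" for n
        using m_le[OF S_add[OF sS S_scaleR[OF v]]] by (simp add: J_expand[OF sS v])
      ultimately have "m \<le> m + t * (2 * (\<Sum>i\<in>I. Re (cinner (q i) (N i v))) - 2 * Re (\<alpha> v)) + t\<^sup>2 * A v"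
        by (intro LIMSEQ_le_const) auto
      then show ?thesis by (simp add: b_def algebra_simps)
    qed
    have "b = 0"
    proof (rule ccontr)
      assume "b \<noteq> 0"
      \<comment> \<open>The test value \<open>t = - b * r\<close> makes the linear term win; the
        summand 1 covers the case \<open>A v = 0\<close>.\<close>
      define r where "r = 1 / (A v + 1)"
      have r: "r > 0" "r * A v = 1 - r" using A0[of v] by (simp_all add: r_def field_simps)
      have "- b * r * (2 * b) + (- b * r)\<^sup>2 * A v = b\<^sup>2 * r * (r * A v - 2)"
        by (simp add: power2_eq_square algebra_simps)
      also have "\<dots> = - (b\<^sup>2 * r * (1 + r))" unfolding r(2) by (simp add: algebra_simps)
      finally have "b\<^sup>2 * r * (1 + r) \<le> 0" using ineq[of "- b * r"] by simp
      moreover have "b\<^sup>2 * r * (1 + r) > 0" using r \<open>b \<noteq> 0\<close> by simp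
      ultimately show False by simp
    qed
    then show ?thesis by (simp add: b_def)
  qed
  \<comment> \<open>The real part at \<open>\<i> *\<^sub>C v\<close> is minus the imaginary part at
    \<open>v\<close>.\<close>
  have "(\<Sum>i\<in>I. cinner (q i) (N i v)) = \<alpha> v" if v: "v \<in> S" for v
  proof (rule complex_eqI)
    have "(\<Sum>i\<in>I. cinner (q i) (N i (\<i> *\<^sub>C v))) = \<i> * (\<Sum>i\<in>I. cinner (q i) (N i v))"
      by (simp add: N_scale v cinner_scaleC_right sum_distrib_left)
    then show "Im (\<Sum>i\<in>I. cinner (q i) (N i v)) = Im (\<alpha> v)"
      using Re_eq[OF S_scale[OF v, of \<i>]] by (simp add: \<alpha>_scale v)
  qed (rule Re_eq[OF v])
  with that sS q show thesis by blast
qed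

section \<open>Adjoints and von Neumann algebras\<close>

lemma blinfun_eq_iff: "S = T \<longleftrightarrow> (\<forall>g. blinfun_apply S g = blinfun_apply T g)"
  by (auto intro: blinfun_eqI)

lemma clinear_opD: "clinear_op T \<Longrightarrow> T (c *\<^sub>C g) = c *\<^sub>C T g"
  by (simp add: clinear_op_def)

text \<open>Riesz representation of \<open>g \<mapsto> cinner h (T g)\<close>, the one-index case of
  \<open>riesz_family\<close>. As \<open>adj\<close> is a definite description, its properties rest
  on this existence together with \<open>adjoint_unique\<close>.\<close>

lemma adjoint_exists:
  fixes T :: "'g::complex_hilbert_space \<Rightarrow>\<^sub>L 'h::complex_hilbert_space"
  assumes T: "clinear_op T"
  shows "\<exists>S :: 'h \<Rightarrow>\<^sub>L 'g. \<forall>g h. cinner (T g) h = cinner g (S h)"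
proof -
  have "\<exists>q. \<forall>g. cinner q g = cinner h (T g)" for h
  proof -
    have bound: "(cmod (cinner h (T g)))\<^sup>2 \<le> (norm h * norm T)\<^sup>2 * (\<Sum>i\<in>{()}. (norm g)\<^sup>2)" for g
    proof -
      have "cmod (cinner h (T g)) \<le> norm h * (norm T * norm g)"
        by (rule order_trans[OF cinner_Cauchy_Schwarz mult_left_mono[OF norm_blinfun]]) simp
      then have "(cmod (cinner h (T g)))\<^sup>2 \<le> (norm h * (norm T * norm g))\<^sup>2"
        by (rule power_mono) simp
      then show ?thesis by (simp add: power_mult_distrib mult.assoc)
    qed
    obtain q where "\<And>g. (\<Sum>i\<in>{()}. cinner (q i) g) = cinner h (T g)"
      by (rule riesz_family[of UNIV "{()}" "\<lambda>_ g. g" "\<lambda>g. cinner h (T g)"])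
        (use bound in \<open>auto simp: blinfun.add_right cinner_add_right clinear_opD[OF T]
          cinner_scaleC_right\<close>)
    then show ?thesis by auto
  qed
  then obtain q where q: "\<And>h g. cinner (q h) g = cinner h (T g)" by metis
  have q': "cinner g (q h) = cinner (T g) h" for g h
    using q[of h g] by (metis cinner_commute)
  have "bounded_linear q"
  proof (rule bounded_linear_intro)
    show "q (x + y) = q x + q y" for x y by (rule cinner_ext) (simp add: q' cinner_add_right)
    show "q (r *\<^sub>R x) = r *\<^sub>R q x" for r x
      by (rule cinner_ext) (simp add: q' scaleR_scaleC[where 'a='g] scaleR_scaleC[where 'a='h]
          cinner_scaleC_right)
    show "norm (q x) \<le> norm x * norm T" for x
    proof (rule norm_le_if_cinner_le)
      show "cmod (cinner z (q x)) \<le> norm x * norm T * norm z" for z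
        unfolding q'
        using order_trans[OF cinner_Cauchy_Schwarz mult_right_mono[OF norm_blinfun[of T z]]]
        by (simp add: mult_ac)
    qed simp
  qed
  then have "cinner (T g) h = cinner g (Blinfun q h)" for g h
    by (simp add: bounded_linear_Blinfun_apply q')
  then show ?thesis by blast
qed

lemma adjoint_unique:
  fixes T :: "'g::complex_hilbert_space \<Rightarrow>\<^sub>L 'h::complex_hilbert_space" and S :: "'h \<Rightarrow>\<^sub>L 'g"
  assumes "\<And>g h. cinner (T g) h = cinner g (S h)"
  shows "adj T = S"
  unfolding adj_def
proof (rule the_equality)
  fix S' :: "'h \<Rightarrow>\<^sub>L 'g" assume "\<forall>g h. cinner (T g) h = cinner g (S' h)"
  then have "cinner z (S' h) = cinner z (S h)" for z h using assms by simp
  then show "S' = S" by (rule blinfun_eqI[OF cinner_ext])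
qed (use assms in blast)

lemma cinner_adj_right:
  fixes T :: "'g::complex_hilbert_space \<Rightarrow>\<^sub>L 'h::complex_hilbert_space"
  assumes "clinear_op T"
  shows "cinner g (adj T h) = cinner (T g) h"
proof -
  obtain S :: "'h \<Rightarrow>\<^sub>L 'g" where S: "\<And>g h. cinner (T g) h = cinner g (S h)"
    using adjoint_exists[OF assms] by blast
  then have "adj T = S" by (rule adjoint_unique)
  with S show ?thesis by simp
qed

lemma cinner_adj_left:
  fixes T :: "'g::complex_hilbert_space \<Rightarrow>\<^sub>L 'h::complex_hilbert_space"
  assumes "clinear_op T"
  shows "cinner (adj T h) g = cinner h (T g)"
  using cinner_adj_right[OF assms, of g h] by (metis cinner_commute)

lemma adj_adj:
  fixes T :: "'g::complex_hilbert_space \<Rightarrow>\<^sub>L 'h::complex_hilbert_space"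
  assumes "clinear_op T"
  shows "adj (adj T) = T"
  by (rule adjoint_unique) (simp add: cinner_adj_left assms)

lemma blinfun_eq_cinnerI:
  fixes S T :: "'g::complex_hilbert_space \<Rightarrow>\<^sub>L 'h::complex_hilbert_space"
  assumes "\<And>f g. cinner f (S g) = cinner f (T g)"
  shows "S = T"
  by (rule blinfun_eqI[OF cinner_ext[OF assms]])

lemma closed_clinear_op: "closed {T :: 'g::complex_normed_vector \<Rightarrow>\<^sub>L 'h::complex_normed_vector. clinear_op T}"
proof -
  have "{T :: 'g \<Rightarrow>\<^sub>L 'h. clinear_op T} = (\<Inter>c. \<Inter>g. {T :: 'g \<Rightarrow>\<^sub>L 'h. T (c *\<^sub>C g) = c *\<^sub>C T g})"
    by (auto simp: clinear_op_def)
  moreover have "closed {T :: 'g \<Rightarrow>\<^sub>L 'h. T (c *\<^sub>C g) = c *\<^sub>C T g}" for c g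
    by (intro closed_Collect_eq continuous_intros bounded_linear.continuous_on[OF bounded_linear_scaleC])
  ultimately show ?thesis by (auto intro!: closed_INT)
qed

text \<open>Norm closedness of the algebra is what later keeps the Banach fixed points inside
  it.\<close>

lemma closed_commutant: "closed (commutant M)"
proof -
  have "commutant M = {T. clinear_op T} \<inter> (\<Inter>A\<in>M. {T. T o\<^sub>L A = A o\<^sub>L T})"
    by (auto simp: commutant_def)
  moreover have "closed {T. T o\<^sub>L A = A o\<^sub>L T}" for A :: "'a \<Rightarrow>\<^sub>L 'a"
    by (intro closed_Collect_eq continuous_intros
        bounded_bilinear.continuous_on[OF bounded_bilinear_blinfun_compose])
  ultimately show ?thesis by (auto intro!: closed_Int closed_clinear_op)
qed

lemma clinear_op_intros:
  "clinear_op id_blinfun" "clinear_op 0"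
  "clinear_op S \<Longrightarrow> clinear_op T \<Longrightarrow> clinear_op (S + T)"
  "clinear_op T \<Longrightarrow> clinear_op (c *\<^sub>C T)"
  by (simp_all add: clinear_op_def blinfun.add_left scaleC_add_right scaleC_scaleC mult.commute)

lemma clinear_op_compose: "clinear_op S \<Longrightarrow> clinear_op T \<Longrightarrow> clinear_op (S o\<^sub>L T)"
  by (simp add: clinear_op_def)

lemma commutant_closed:
  "id_blinfun \<in> commutant M"
  "0 \<in> commutant M"
  "\<lbrakk>S \<in> commutant M; T \<in> commutant M\<rbrakk> \<Longrightarrow> S + T \<in> commutant M"
  "\<lbrakk>S \<in> commutant M; T \<in> commutant M\<rbrakk> \<Longrightarrow> S o\<^sub>L T \<in> commutant M"
proof -
  show "id_blinfun \<in> commutant M" "0 \<in> commutant M"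
    by (simp_all add: commutant_def clinear_op_intros blinfun_eq_iff)
  show "S + T \<in> commutant M" if "S \<in> commutant M" "T \<in> commutant M"
    using that by (simp add: commutant_def clinear_op_intros
        bounded_bilinear.add_left[OF bounded_bilinear_blinfun_compose]
        bounded_bilinear.add_right[OF bounded_bilinear_blinfun_compose])
  show "S o\<^sub>L T \<in> commutant M" if "S \<in> commutant M" "T \<in> commutant M"
    using that by (simp add: commutant_def clinear_op_compose blinfun_eq_iff)
qed

lemma commutant_scaleC:
  assumes "\<And>A. A \<in> M \<Longrightarrow> clinear_op A" "T \<in> commutant M"
  shows "c *\<^sub>C T \<in> commutant M"
  using assms clinear_op_intros(4) by (auto simp: commutant_def blinfun_eq_iff clinear_opD)

lemma id_blinfun_compose [simp]: "id_blinfun o\<^sub>L T = T" "T o\<^sub>L id_blinfun = T"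
  by (simp_all add: blinfun_eq_iff)

locale vn_algebra =
  fixes B :: "('g::complex_hilbert_space \<Rightarrow>\<^sub>L 'g) set"
  assumes vn: "von_neumann_algebra B"
begin

lemma bicommutant: "commutant (commutant B) = B"
  using vn by (simp add: von_neumann_algebra_def)

lemma clinear: "b \<in> B \<Longrightarrow> clinear_op b"
  using vn by (simp add: von_neumann_algebra_def)

lemma adj_closed: "b \<in> B \<Longrightarrow> adj b \<in> B"
  using vn by (simp add: von_neumann_algebra_def)

lemma one_closed: "id_blinfun \<in> B" and zero_closed: "0 \<in> B"
  and add_closed: "\<lbrakk>a \<in> B; b \<in> B\<rbrakk> \<Longrightarrow> a + b \<in> B"
  and compose_closed: "\<lbrakk>a \<in> B; b \<in> B\<rbrakk> \<Longrightarrow> a o\<^sub>L b \<in> B"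
  using commutant_closed[where M = "commutant B"] by (simp_all add: bicommutant)

lemma scaleC_closed: "b \<in> B \<Longrightarrow> c *\<^sub>C b \<in> B"
  by (rule commutant_scaleC[where M = "commutant B", unfolded bicommutant])
    (auto simp: commutant_def)

lemma closed: "closed B"
  using closed_commutant[of "commutant B"] by (simp add: bicommutant)

lemma adj_right: "b \<in> B \<Longrightarrow> cinner g (adj b h) = cinner (b g) h"
  by (rule cinner_adj_right[OF clinear])

lemma adj_left: "b \<in> B \<Longrightarrow> cinner (adj b h) g = cinner h (b g)"
  by (rule cinner_adj_left[OF clinear])

lemma adj_involution: "b \<in> B \<Longrightarrow> adj (adj b) = b"
  by (rule adj_adj[OF clinear])

end

text \<open>\<open>p\<close> is the orthogonal projection of \<open>g\<close> to the closure of the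
  image of \<open>S\<close>. The approximating sequence is returned in \<open>S\<close> rather than
  in the Hilbert space: in the application its terms are algebra elements, which can act on module
  vectors.\<close>

lemma projection_exists:
  fixes N :: "'v::complex_vector \<Rightarrow> 'h::complex_hilbert_space"
  assumes "0 \<in> S" "\<And>u v. u \<in> S \<Longrightarrow> v \<in> S \<Longrightarrow> u + v \<in> S" "\<And>c u. u \<in> S \<Longrightarrow> c *\<^sub>C u \<in> S"
    and add: "\<And>u v. u \<in> S \<Longrightarrow> v \<in> S \<Longrightarrow> N (u + v) = N u + N v"
    and scale: "\<And>c u. u \<in> S \<Longrightarrow> N (c *\<^sub>C u) = c *\<^sub>C N u"
  obtains p s where "\<And>n. s n \<in> S" "(\<lambda>n::nat. N (s n)) \<longlonglongrightarrow> p"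
    "\<And>v. v \<in> S \<Longrightarrow> cinner (g - p) (N v) = 0"
proof -
  obtain q s where "\<And>n. s n \<in> S" "\<And>i. i \<in> {()} \<Longrightarrow> (\<lambda>n::nat. N (s n)) \<longlonglongrightarrow> q i"
    "\<And>v. v \<in> S \<Longrightarrow> (\<Sum>i\<in>{()}. cinner (q i) (N v)) = cinner g (N v)"
  proof (rule riesz_family[of S "{()}" "\<lambda>_. N" "\<lambda>v. cinner g (N v)" "(norm g)\<^sup>2"])
    show "(cmod (cinner g (N v)))\<^sup>2 \<le> (norm g)\<^sup>2 * (\<Sum>i\<in>{()}. (norm (N v))\<^sup>2)" for v
      using power_mono[OF cinner_Cauchy_Schwarz, of g "N v" 2] by (simp add: power_mult_distrib)
  qed (use assms in \<open>auto simp: cinner_add_right cinner_scaleC_right\<close>)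
  then show thesis using that[of s "q ()"] by (simp add: cinner_diff_left)
qed

section \<open>Positivity of Gram matrices\<close>

locale vn_module = alg: vn_algebra B + hilbert_module B E
  for B :: "('g::complex_hilbert_space \<Rightarrow>\<^sub>L 'g) set"
    and E :: "('e::complex_vector, 'a, 'g \<Rightarrow>\<^sub>L 'g) bimodule"
begin

lemma uminus_closed: "x \<in> carrier E \<Longrightarrow> - x \<in> carrier E"
  using scaleC_closed[of x "-1"] by (simp add: scaleC_minus1)

lemma diff_closed: "\<lbrakk>x \<in> carrier E; y \<in> carrier E\<rbrakk> \<Longrightarrow> x - y \<in> carrier E"
  using add_closed[of x "- y"] by (simp add: uminus_closed)

lemma sum_closed: "(\<And>i. i \<in> I \<Longrightarrow> v i \<in> carrier E) \<Longrightarrow> sum v I \<in> carrier E"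
  by (induction I rule: infinite_finite_induct) (auto simp: zero_closed add_closed)

lemma cinner_ip:
  "\<lbrakk>x \<in> carrier E; y \<in> carrier E\<rbrakk> \<Longrightarrow> cinner f (ip E x y g) = cinner (ip E y x f) g"
  by (subst ip_adj) (simp_all add: alg.adj_right ip_closed)

lemma ip_add_left:
  "\<lbrakk>x \<in> carrier E; y \<in> carrier E; z \<in> carrier E\<rbrakk> \<Longrightarrow> ip E (x + y) z = ip E x z + ip E y z"
  by (rule blinfun_eq_cinnerI)
    (simp add: cinner_ip add_closed ip_add_right cinner_add_left cinner_add_right blinfun.add_left)

lemma ip_zero_right: "x \<in> carrier E \<Longrightarrow> ip E x 0 = 0"
  using ip_add_right[of x 0 0] by (simp add: zero_closed)

lemma ip_diff_right:
  assumes "x \<in> carrier E" "y \<in> carrier E" "z \<in> carrier E"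
  shows "ip E x (y - z) = ip E x y - ip E x z"
  using ip_add_right[of x "y - z" z] assms by (simp add: diff_closed)

lemma ip_diff_left:
  assumes "x \<in> carrier E" "y \<in> carrier E" "z \<in> carrier E"
  shows "ip E (x - y) z = ip E x z - ip E y z"
  using ip_add_left[of "x - y" y z] assms by (simp add: diff_closed)

lemma ip_ract_left:
  "\<lbrakk>x \<in> carrier E; y \<in> carrier E; b \<in> B\<rbrakk> \<Longrightarrow> ip E (ract E x b) y = adj b o\<^sub>L ip E x y"
  by (rule blinfun_eq_cinnerI)
    (simp add: cinner_ip ract_closed ip_ract_right alg.adj_right alg.adj_left)

lemma ip_sum_right:
  "\<lbrakk>x \<in> carrier E; \<And>i. i \<in> I \<Longrightarrow> v i \<in> carrier E\<rbrakk> \<Longrightarrow> ip E x (sum v I) = (\<Sum>i\<in>I. ip E x (v i))"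
  by (induction I rule: infinite_finite_induct) (auto simp: ip_zero_right ip_add_right sum_closed)

text \<open>When all test vectors are of the form \<open>b i g\<close> with a common
  \<open>g\<close>, the Gram form is the inner square of one module element, hence positive by
  \<open>ip_positive\<close>.\<close>

lemma cinner_ip_sum_ract:
  assumes v: "\<And>i. i \<in> I \<Longrightarrow> v i \<in> carrier E" and b: "\<And>i. i \<in> I \<Longrightarrow> b i \<in> B"
  shows "cinner g (ip E (\<Sum>i\<in>I. ract E (v i) (b i)) (\<Sum>i\<in>I. ract E (v i) (b i)) g)
    = (\<Sum>i\<in>I. \<Sum>j\<in>I. cinner (b i g) (ip E (v i) (v j) (b j g)))"
proof -
  define w where "w = (\<Sum>i\<in>I. ract E (v i) (b i))"
  have vb: "i \<in> I \<Longrightarrow> ract E (v i) (b i) \<in> carrier E" for i by (simp add: v b ract_closed)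
  have w: "w \<in> carrier E" unfolding w_def by (rule sum_closed) (rule vb)
  have "cinner g (ip E w w g) = (\<Sum>j\<in>I. cinner g (ip E w (ract E (v j) (b j)) g))"
    by (subst (2) w_def) (simp add: ip_sum_right w vb blinfun.sum_left cinner_sum_right)
  also have "\<dots> = (\<Sum>j\<in>I. \<Sum>i\<in>I. cinner (b i g) (ip E (v i) (v j) (b j g)))"
  proof (rule sum.cong[OF refl])
    fix j assume j: "j \<in> I"
    have "cinner g (ip E w (ract E (v j) (b j)) g)
        = (\<Sum>i\<in>I. cinner (ip E (v j) (ract E (v i) (b i)) g) (b j g))"
      unfolding ip_ract_right[OF w v[OF j] b[OF j]]
      by (simp add: cinner_ip w v j)
        (simp add: w_def ip_sum_right v j vb blinfun.sum_left cinner_sum_left)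
    also have "\<dots> = (\<Sum>i\<in>I. cinner (b i g) (ip E (v i) (v j) (b j g)))"
      by (rule sum.cong[OF refl]) (simp add: ip_ract_right v j b cinner_ip)
    finally show "cinner g (ip E w (ract E (v j) (b j)) g)
        = (\<Sum>i\<in>I. cinner (b i g) (ip E (v i) (v j) (b j g)))" .
  qed
  also have "\<dots> = (\<Sum>i\<in>I. \<Sum>j\<in>I. cinner (b i g) (ip E (v i) (v j) (b j g)))" by (rule sum.swap)
  finally show ?thesis unfolding w_def .
qed

text \<open>If all \<open>g i\<close> lie in the closure of a cyclic subspace \<open>B k\<close>, approximate them by
  \<open>b i k\<close>; in general split off the components in such subspaces one after the other.\<close>

lemma gram_nonneg:
  assumes I: "finite I" and v: "\<And>i. i \<in> I \<Longrightarrow> v i \<in> carrier E"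
  shows "0 \<le> Re (\<Sum>i\<in>I. \<Sum>j\<in>I. cinner (g i) (ip E (v i) (v j) (g j)))"
proof (induction "card {i \<in> I. g i \<noteq> 0}" arbitrary: g rule: less_induct)
  case less
  show ?case
  proof (cases "\<exists>k\<in>I. g k \<noteq> 0")
    case False
    then show ?thesis by simp
  next
    case True
    then obtain k where k: "k \<in> I" "g k \<noteq> 0" by blast
    have "\<exists>p s. (\<forall>n. s n \<in> B) \<and> (\<lambda>n::nat. blinfun_apply (s n) (g k)) \<longlonglongrightarrow> p
        \<and> (\<forall>b\<in>B. cinner (g i - p) (blinfun_apply b (g k)) = 0)" for i
      by (rule projection_exists[of B "\<lambda>b. blinfun_apply b (g k)" "g i"])
        (auto simp: alg.zero_closed alg.add_closed alg.scaleC_closed blinfun.add_left)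
    then obtain p s where s: "\<And>i n. s i n \<in> B"
      and p: "\<And>i. (\<lambda>n::nat. blinfun_apply (s i n) (g k)) \<longlonglongrightarrow> p i"
      and perp: "\<And>i b. b \<in> B \<Longrightarrow> cinner (g i - p i) (blinfun_apply b (g k)) = 0"
      by metis
    define h where "h i = g i - p i" for i
    \<comment> \<open>The closure of the cyclic subspace is invariant under the algebra, so
      \<open>h i\<close> is orthogonal to \<open>b (p j)\<close> and not only to
      \<open>b (g k)\<close>.\<close>
    have h_perp: "cinner (h i) (b (p j)) = 0" if b: "b \<in> B" for i j and b :: "'g \<Rightarrow>\<^sub>L 'g"
    proof -
      have "(\<lambda>n. cinner (h i) (b (s j n (g k)))) \<longlonglongrightarrow> cinner (h i) (b (p j))"
        by (intro tendsto_intros p)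
      moreover have "cinner (h i) (b (s j n (g k))) = 0" for n
        using perp[OF alg.compose_closed[OF b s], of i j n] by (simp add: h_def)
      ultimately show ?thesis by (simp add: LIMSEQ_const_iff)
    qed
    \<comment> \<open>Invariance under adjoints makes the complement invariant as well; hence no
      entry of the Gram matrix mixes \<open>p\<close> and \<open>h\<close> components.\<close>
    have p_perp: "cinner (p i) (b (h j)) = 0" if b: "b \<in> B" for i j and b :: "'g \<Rightarrow>\<^sub>L 'g"
    proof -
      have "cinner (p i) (b (h j)) = cnj (cinner (h j) (adj b (p i)))"
        by (subst cinner_commute) (simp add: alg.adj_right b)
      then show ?thesis using h_perp[OF alg.adj_closed[OF b]] by simp
    qed
    \<comment> \<open>A vector of the cyclic subspace leaves no remainder. The identity gives this
      for index \<open>k\<close>, and 0 keeps vanishing entries zero, so the support strictly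
      shrinks and the induction hypothesis applies to \<open>h\<close>.\<close>
    have h_zero: "h i = 0" if "g i = b (g k)" "b \<in> B" for i and b :: "'g \<Rightarrow>\<^sub>L 'g"
    proof -
      have "cinner (h i) (h i) = cinner (h i) (b (g k)) - cinner (h i) (id_blinfun (p i))"
        by (simp add: h_def that cinner_diff_right)
      also have "\<dots> = 0"
        using perp[OF that(2), of i] h_perp[OF alg.one_closed, of i i] by (simp add: h_def)
      finally show ?thesis by simp
    qed
    have "h k = 0" by (rule h_zero[of k id_blinfun]) (simp_all add: alg.one_closed)
    moreover have "h i = 0" if "g i = 0" for i
      by (rule h_zero[of i 0]) (simp_all add: that alg.zero_closed)
    ultimately have "{i \<in> I. h i \<noteq> 0} \<subset> {i \<in> I. g i \<noteq> 0}" using k by blast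
    then have "card {i \<in> I. h i \<noteq> 0} < card {i \<in> I. g i \<noteq> 0}"
      by (rule psubset_card_mono[rotated]) (use I in simp)
    then have pos_h: "0 \<le> Re (\<Sum>i\<in>I. \<Sum>j\<in>I. cinner (h i) (ip E (v i) (v j) (h j)))"
      by (rule less)
    have pos_p: "0 \<le> Re (\<Sum>i\<in>I. \<Sum>j\<in>I. cinner (p i) (ip E (v i) (v j) (p j)))"
    proof (rule LIMSEQ_le_const)
      show "(\<lambda>n. Re (\<Sum>i\<in>I. \<Sum>j\<in>I. cinner (s i n (g k)) (ip E (v i) (v j) (s j n (g k)))))
          \<longlonglongrightarrow> Re (\<Sum>i\<in>I. \<Sum>j\<in>I. cinner (p i) (ip E (v i) (v j) (p j)))"
        by (intro tendsto_intros p)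
      have "0 \<le> Re (\<Sum>i\<in>I. \<Sum>j\<in>I. cinner (s i n (g k)) (ip E (v i) (v j) (s j n (g k))))" for n
      proof -
        have "(\<Sum>i\<in>I. ract E (v i) (s i n)) \<in> carrier E"
          by (intro sum_closed ract_closed v s)
        from ip_positive[OF this] show ?thesis
          by (simp add: positive_op_def complex_nonneg_Reals_iff cinner_ip_sum_ract[OF v s])
      qed
      then show "\<exists>N. \<forall>n\<ge>N. 0 \<le> Re (\<Sum>i\<in>I. \<Sum>j\<in>I.
          cinner (s i n (g k)) (ip E (v i) (v j) (s j n (g k))))" by blast
    qed
    have "(\<Sum>i\<in>I. \<Sum>j\<in>I. cinner (g i) (ip E (v i) (v j) (g j)))
        = (\<Sum>i\<in>I. \<Sum>j\<in>I. cinner (p i) (ip E (v i) (v j) (p j))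
            + cinner (h i) (ip E (v i) (v j) (h j)))"
    proof (intro sum.cong refl)
      fix i j assume "i \<in> I" "j \<in> I"
      then have T: "ip E (v i) (v j) \<in> B" by (simp add: ip_closed v)
      have "g i = p i + h i" "g j = p j + h j" by (simp_all add: h_def)
      then show "cinner (g i) (ip E (v i) (v j) (g j)) = cinner (p i) (ip E (v i) (v j) (p j))
            + cinner (h i) (ip E (v i) (v j) (h j))"
        by (simp add: blinfun.add_right cinner_add_left cinner_add_right h_perp p_perp T)
    qed
    then show ?thesis using pos_p pos_h by (simp add: sum.distrib)
  qed
qed

text \<open>Positivity of the Gram matrix of \<open>x\<close> and \<open>v\<close>, tested on
  \<open>- f\<close> and \<open>g\<close> with \<open>f = ip E x v g\<close>: three of the four
  terms combine to minus the squared norm of \<open>f\<close>. This form of Cauchy-Schwarz needs no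
  tensor product, so it is available in the common module.\<close>

lemma norm_ip_le_mod_norm:
  assumes x: "x \<in> carrier E" and v: "v \<in> carrier E" and one: "ip E x x = id_blinfun"
  shows "norm (ip E x v) \<le> mod_norm E v"
proof (rule norm_blinfun_bound)
  show "0 \<le> mod_norm E v" by (simp add: mod_norm_def)
  fix g
  define f where "f = ip E x v g"
  define V where "V i = (if i then x else v)" for i
  have V: "V i \<in> carrier E" for i using x v by (simp add: V_def)
  have "cinner g (ip E v x f) = cinner f f"
    by (simp add: cinner_ip x v f_def)
  then have "0 \<le> Re (cinner g (ip E v v g)) - (norm f)\<^sup>2"
    using gram_nonneg[of UNIV V "\<lambda>i. if i then - f else g"] V
    by (simp add: UNIV_bool V_def one blinfun.minus_right cinner_minus_left cinner_minus_right
        Re_cinner_self flip: f_def)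
  also have "Re (cinner g (ip E v v g)) \<le> cmod (cinner g (ip E v v g))" by (rule complex_Re_le_cmod)
  also have "\<dots> \<le> norm g * norm (ip E v v g)" by (rule cinner_Cauchy_Schwarz)
  also have "\<dots> \<le> norm g * (norm (ip E v v) * norm g)"
    by (intro mult_left_mono norm_blinfun) simp
  finally have "(norm f)\<^sup>2 \<le> (mod_norm E v * norm g)\<^sup>2"
    by (simp add: mod_norm_def power_mult_distrib power2_eq_square[of "norm g"] algebra_simps)
  then show "norm (ip E x v g) \<le> mod_norm E v * norm g"
    unfolding f_def by (rule power2_le_imp_le) (simp add: mod_norm_def)
qed

end

section \<open>Left actions, vectors representing the identity, and domination\<close>

locale vn_correspondence = vn_module B E + hilbert_bimodule B B E
  for B :: "('g::complex_hilbert_space \<Rightarrow>\<^sub>L 'g) set"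
    and E :: "('e::complex_vector, 'g \<Rightarrow>\<^sub>L 'g, 'g \<Rightarrow>\<^sub>L 'g) bimodule"
begin

text \<open>Additivity in the module variable comes from adjointability: moving \<open>a\<close> to
  the other side shows that the defect \<open>d\<close> is orthogonal to itself.\<close>

lemma lact_add_right:
  assumes a: "a \<in> B" and x: "x \<in> carrier E" "y \<in> carrier E"
  shows "lact E a (x + y) = lact E a x + lact E a y"
proof -
  define d where "d = lact E a (x + y) - (lact E a x + lact E a y)"
  have ax: "lact E a x \<in> carrier E" "lact E a y \<in> carrier E" "lact E a (x + y) \<in> carrier E"
    by (simp_all add: lact_closed a x add_closed)
  have d: "d \<in> carrier E" unfolding d_def by (intro diff_closed add_closed ax)
  have "ip E d (lact E a v) = ip E (lact E (adj a) d) v" if "v \<in> carrier E" for v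
    using lact_adj[OF alg.adj_closed[OF a] d that] by (simp add: alg.adj_involution a)
  then have "ip E d d = 0"
    by (subst (2) d_def)
      (simp add: ip_diff_right ip_add_right d ax add_closed x lact_closed alg.adj_closed a)
  then show ?thesis using ip_definite[OF d] by (simp add: d_def)
qed

lemma ip_lact_lact:
  "\<lbrakk>a \<in> B; b \<in> B; x \<in> carrier E; y \<in> carrier E\<rbrakk>
    \<Longrightarrow> ip E (lact E a x) (lact E b y) = ip E x (lact E (adj a o\<^sub>L b) y)"
  by (simp add: lact_adj lact_closed lact_compose alg.adj_closed)

text \<open>Each of the four terms in the inner square of \<open>a x - x a\<close> equals
  \<open>adj a o\<^sub>L a\<close>, and they cancel.\<close>

lemma central_if_represents_id:
  assumes x: "x \<in> carrier E" and id: "\<And>a. a \<in> B \<Longrightarrow> ip E x (lact E a x) = a" and a: "a \<in> B"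
  shows "lact E a x = ract E x a"
proof -
  have ax: "lact E a x \<in> carrier E" and xa: "ract E x a \<in> carrier E"
    by (simp_all add: lact_closed ract_closed x a)
  have one: "ip E x x = id_blinfun" using id[OF alg.one_closed] by (simp add: lact_one x)
  have "ip E (lact E a x) x = adj a"
    by (subst ip_adj) (simp_all add: ax x id a)
  then have "ip E (lact E a x - ract E x a) (lact E a x - ract E x a) = 0"
    by (simp add: ip_diff_left ip_diff_right ax xa diff_closed ip_lact_lact a x id
        ip_ract_right ip_ract_left one alg.compose_closed alg.adj_closed)
  then show ?thesis using ip_definite[OF diff_closed[OF ax xa]] by simp
qed

text \<open>Moved to the left, \<open>a\<close> acts as \<open>adj a\<close> on \<open>x\<close>; by
  centrality this is a right action, which comes out of the first argument as
  \<open>a\<close>.\<close>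

lemma ip_central_lact:
  assumes x: "x \<in> carrier E" and central: "\<And>a. a \<in> B \<Longrightarrow> lact E a x = ract E x a"
    and a: "a \<in> B" and y: "y \<in> carrier E"
  shows "ip E x (lact E a y) = a o\<^sub>L ip E x y"
  using lact_adj[OF alg.adj_closed[OF a] x y]
  by (simp add: central alg.adj_closed alg.adj_involution a ip_ract_left x y)

text \<open>The vector \<open>v i\<close> is what remains of \<open>a i y\<close> after removing its
  component \<open>x (a i c)\<close> along \<open>x\<close>. The Gram form of these remainders is
  the right side minus the left side, hence nonnegative.\<close>

lemma gram_dominates:
  assumes x: "x \<in> carrier E" and id: "\<And>a. a \<in> B \<Longrightarrow> ip E x (lact E a x) = a"
    and y: "y \<in> carrier E" and I: "finite I" and a: "\<And>i. i \<in> I \<Longrightarrow> a i \<in> B"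
  shows "(norm (\<Sum>i\<in>I. blinfun_apply (a i) (ip E x y (f i))))\<^sup>2
    \<le> Re (\<Sum>i\<in>I. \<Sum>j\<in>I. cinner (f i) (ip E y (lact E (adj (a i) o\<^sub>L a j) y) (f j)))"
proof -
  define c where "c = ip E x y"
  define v where "v i = lact E (a i) y - ract E x (a i o\<^sub>L c)" for i
  have central: "lact E b x = ract E x b" if "b \<in> B" for b
    by (rule central_if_represents_id[OF x id that])
  have one: "ip E x x = id_blinfun" using id[OF alg.one_closed] by (simp add: lact_one x)
  have c: "c \<in> B" by (simp add: c_def ip_closed x y)
  have ac: "a i o\<^sub>L c \<in> B" if "i \<in> I" for i by (simp add: alg.compose_closed a c that)
  have ay: "lact E (a i) y \<in> carrier E" and xac: "ract E x (a i o\<^sub>L c) \<in> carrier E" if "i \<in> I" for i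
    by (simp_all add: lact_closed ract_closed x y a ac that)
  have v: "v i \<in> carrier E" if "i \<in> I" for i by (simp add: v_def diff_closed ay xac that)
  have xay: "ip E x (lact E (a i) y) = a i o\<^sub>L c" if "i \<in> I" for i
    unfolding c_def by (rule ip_central_lact[OF x central a[OF that] y])
  \<comment> \<open>Both mixed terms and the square of the subtracted vector give the same number,
    so it survives exactly once, with a minus sign.\<close>
  have vv: "cinner (f i) (ip E (v i) (v j) (f j))
      = cinner (f i) (ip E y (lact E (adj (a i) o\<^sub>L a j) y) (f j))
        - cinner (a i (c (f i))) (a j (c (f j)))" if i: "i \<in> I" and j: "j \<in> I" for i j
  proof -
    have "cinner (f i) (ip E (lact E (a i) y) (ract E x (a j o\<^sub>L c)) (f j))
        = cinner (a i (c (f i))) (a j (c (f j)))"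
      unfolding ip_ract_right[OF ay[OF i] x ac[OF j]]
      by (simp add: cinner_ip ay i x xay)
    moreover have "cinner (f i) (ip E (ract E x (a i o\<^sub>L c)) (lact E (a j) y) (f j))
        = cinner (a i (c (f i))) (a j (c (f j)))"
      unfolding ip_ract_left[OF x ay[OF j] ac[OF i]]
      by (simp add: alg.adj_right ac i xay j)
    moreover have "cinner (f i) (ip E (ract E x (a i o\<^sub>L c)) (ract E x (a j o\<^sub>L c)) (f j))
        = cinner (a i (c (f i))) (a j (c (f j)))"
      unfolding ip_ract_left[OF x xac[OF j] ac[OF i]] ip_ract_right[OF x x ac[OF j]]
      by (simp add: alg.adj_right ac i one)
    ultimately show ?thesis
      by (simp add: v_def ip_diff_left ip_diff_right ay xac i j diff_closed blinfun.diff_left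
          cinner_diff_right ip_lact_lact a y)
  qed
  have "0 \<le> Re (\<Sum>i\<in>I. \<Sum>j\<in>I. cinner (f i) (ip E (v i) (v j) (f j)))"
    by (rule gram_nonneg[OF I v])
  also have "(\<Sum>i\<in>I. \<Sum>j\<in>I. cinner (f i) (ip E (v i) (v j) (f j)))
      = (\<Sum>i\<in>I. \<Sum>j\<in>I. cinner (f i) (ip E y (lact E (adj (a i) o\<^sub>L a j) y) (f j)))
        - cinner (\<Sum>i\<in>I. blinfun_apply (a i) (c (f i))) (\<Sum>i\<in>I. blinfun_apply (a i) (c (f i)))"
    by (simp add: vv sum_subtractf cinner_sum_left cinner_sum_right) (rule sum.swap)
  finally show ?thesis by (simp add: Re_cinner_self c_def)
qed

end

section \<open>Strong density\<close>

lemma cinner_closure_span_eq_zero: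
  fixes h :: "'h::complex_inner"
  assumes "v \<in> closure (span X)" and "\<And>x. x \<in> X \<Longrightarrow> cinner h x = 0"
  shows "cinner h v = 0"
proof -
  have "subspace {v. cinner h v = 0}"
    by (auto simp: subspace_def cinner_add_right cinner_scaleC_right scaleR_scaleC)
  then have "span X \<subseteq> {v. cinner h v = 0}"
    by (rule span_minimal[rotated]) (use assms(2) in blast)
  moreover have "closed {v. cinner h v = 0}"
    by (intro closed_Collect_eq continuous_intros)
  ultimately have "closure (span X) \<subseteq> {v. cinner h v = 0}" by (rule closure_minimal)
  with assms(1) show ?thesis by blast
qed

text \<open>A basic strong neighbourhood of \<open>T\<close> constrains the values at finitely many
  vectors only. Once these are fixed, sequences suffice, and the sequence may depend on the finite
  set.\<close>

lemma strong_operator_closedD: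
  fixes T :: "'g::real_normed_vector \<Rightarrow>\<^sub>L 'h::real_normed_vector"
  assumes A: "closedin (subtopology strong_operator_topology K) A" and T: "T \<in> K"
    and approx: "\<And>I. finite I \<Longrightarrow> \<exists>S. (\<forall>n. S n \<in> A) \<and> (\<forall>g\<in>I. (\<lambda>n::nat. blinfun_apply (S n) g) \<longlonglongrightarrow> T g)"
  shows "T \<in> A"
proof (rule ccontr)
  assume "T \<notin> A"
  obtain C where C: "closedin strong_operator_topology C" "A = C \<inter> K"
    using A by (auto simp: closedin_subtopology)
  then have "openin strong_operator_topology (- C)"
    by (simp add: closedin_def strong_operator_topology_topspace Compl_eq_Diff_UNIV)
  then obtain V where V: "open V" "- C = blinfun_apply -` V"
    unfolding strong_operator_topology_def by (auto simp: openin_pullback_topology)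
  have "blinfun_apply T \<in> V" using V(2) C(2) T \<open>T \<notin> A\<close> by blast
  moreover have "openin (product_topology (\<lambda>_. euclidean) UNIV) V"
    using V(1) by (simp add: euclidean_product_topology)
  ultimately obtain X where X: "blinfun_apply T \<in> (\<Pi>\<^sub>E i\<in>UNIV. X i)" "\<And>i. open (X i)"
    "finite {i. X i \<noteq> UNIV}" "(\<Pi>\<^sub>E i\<in>UNIV. X i) \<subseteq> V"
    using product_topology_open_contains_basis[of "\<lambda>_. euclidean" UNIV V "blinfun_apply T"]
    by auto
  define I where "I = {i. X i \<noteq> UNIV}"
  obtain S where S: "\<And>n. S n \<in> A" "\<And>g. g \<in> I \<Longrightarrow> (\<lambda>n::nat. blinfun_apply (S n) g) \<longlonglongrightarrow> T g"
    using approx[of I] X(3) unfolding I_def by blast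
  have "\<forall>\<^sub>F n in sequentially. \<forall>g\<in>I. blinfun_apply (S n) g \<in> X g"
  proof (rule eventually_ball_finite)
    show "finite I" using X(3) by (simp add: I_def)
    show "\<forall>g\<in>I. \<forall>\<^sub>F n in sequentially. blinfun_apply (S n) g \<in> X g"
      using X(1) by (auto intro!: topological_tendstoD[OF S(2) X(2)])
  qed
  then obtain n where n: "\<And>g. g \<in> I \<Longrightarrow> blinfun_apply (S n) g \<in> X g"
    by (auto simp: eventually_sequentially)
  have "blinfun_apply (S n) g \<in> X g" for g
    using n[of g] by (cases "g \<in> I") (auto simp: I_def)
  then have "blinfun_apply (S n) \<in> V" using X(4) by (auto simp: PiE_def)
  then show False using S(1)[of n] V(2) C(2) by blast
qed

section \<open>Modules realised as operators \<open>L x\<close> into a Hilbert space\<close>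

locale embedded_module = vn_module B E
  for B :: "('g::complex_hilbert_space \<Rightarrow>\<^sub>L 'g) set"
    and E :: "('e::complex_vector, 'a, 'g \<Rightarrow>\<^sub>L 'g) bimodule" +
  fixes L :: "'e \<Rightarrow> 'g \<Rightarrow>\<^sub>L 'h::complex_hilbert_space"
  assumes embedding: "tensor_embedding E L"
begin

lemma cinner_L:
  "\<lbrakk>x \<in> carrier E; y \<in> carrier E\<rbrakk> \<Longrightarrow> cinner (L x f) (L y g) = cinner f (ip E x y g)"
  using embedding by (simp add: tensor_embedding_def)

text \<open>Only preservation of inner products is given for \<open>L\<close>. The defect
  \<open>d\<close> is orthogonal to every \<open>L w f\<close> and is itself a combination of such
  vectors, so it vanishes; the same argument yields the next three lemmas.\<close>

lemma L_add: "\<lbrakk>x \<in> carrier E; y \<in> carrier E\<rbrakk> \<Longrightarrow> L (x + y) g = L x g + L y g"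
proof -
  assume xy: "x \<in> carrier E" "y \<in> carrier E"
  define d where "d = L (x + y) g - (L x g + L y g)"
  have "cinner (L w f) d = 0" if "w \<in> carrier E" for w f
    using that xy by (simp add: d_def cinner_diff_right cinner_add_right cinner_L add_closed
        ip_add_right blinfun.add_left)
  then have "cinner d d = 0"
    by (subst d_def) (simp add: cinner_diff_left cinner_add_left xy add_closed)
  then show ?thesis by (simp add: d_def)
qed

lemma L_scaleC: "x \<in> carrier E \<Longrightarrow> L (c *\<^sub>C x) g = c *\<^sub>C L x g"
proof -
  assume x: "x \<in> carrier E"
  define d where "d = L (c *\<^sub>C x) g - c *\<^sub>C L x g"
  have "cinner (L w f) d = 0" if "w \<in> carrier E" for w f
    using that x by (simp add: d_def cinner_diff_right cinner_scaleC_right cinner_L scaleC_closed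
        ip_scaleC_right)
  then have "cinner d d = 0"
    by (subst d_def) (simp add: cinner_diff_left cinner_scaleC_left x scaleC_closed)
  then show ?thesis by (simp add: d_def)
qed

lemma L_ract: "\<lbrakk>x \<in> carrier E; b \<in> B\<rbrakk> \<Longrightarrow> L (ract E x b) g = L x (b g)"
proof -
  assume x: "x \<in> carrier E" "b \<in> B"
  define d where "d = L (ract E x b) g - L x (b g)"
  have "cinner (L w f) d = 0" if "w \<in> carrier E" for w f
    using that x by (simp add: d_def cinner_diff_right cinner_L ract_closed ip_ract_right)
  then have "cinner d d = 0"
    by (subst d_def) (simp add: cinner_diff_left x ract_closed)
  then show ?thesis by (simp add: d_def)
qed

lemma clinear_L: "x \<in> carrier E \<Longrightarrow> clinear_op (L x)"
proof -
  assume x: "x \<in> carrier E"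
  have "L x (c *\<^sub>C g) = c *\<^sub>C L x g" for c g
  proof -
    define d where "d = L x (c *\<^sub>C g) - c *\<^sub>C L x g"
    have "cinner (L w f) d = 0" if "w \<in> carrier E" for w f
      using that x by (simp add: d_def cinner_diff_right cinner_scaleC_right cinner_L
          clinear_opD[OF alg.clinear] ip_closed)
    then have "cinner d d = 0"
      by (subst d_def) (simp add: cinner_diff_left cinner_scaleC_left x)
    then show ?thesis by (simp add: d_def)
  qed
  then show ?thesis by (simp add: clinear_op_def)
qed

lemma adj_L_L: "\<lbrakk>x \<in> carrier E; y \<in> carrier E\<rbrakk> \<Longrightarrow> adj (L x) (L y g) = ip E x y g"
  by (rule cinner_ext) (simp add: cinner_adj_right clinear_L cinner_L)

lemma norm_ip_le: "\<lbrakk>x \<in> carrier E; y \<in> carrier E\<rbrakk> \<Longrightarrow> norm (ip E x y) \<le> norm (L x) * norm (L y)"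
proof (rule norm_blinfun_bound)
  fix g assume xy: "x \<in> carrier E" "y \<in> carrier E"
  show "norm (ip E x y g) \<le> norm (L x) * norm (L y) * norm g"
  proof (rule norm_le_if_cinner_le)
    fix f
    have "cmod (cinner f (ip E x y g)) \<le> norm (L x f) * norm (L y g)"
      using cinner_Cauchy_Schwarz[of "L x f" "L y g"] by (simp add: cinner_L xy)
    also have "\<dots> \<le> (norm (L x) * norm f) * (norm (L y) * norm g)"
      by (intro mult_mono norm_blinfun) auto
    finally show "cmod (cinner f (ip E x y g)) \<le> norm (L x) * norm (L y) * norm g * norm f"
      by (simp add: mult_ac)
  qed simp
qed simp

text \<open>With \<open>norm_ip_le\<close> this makes \<open>ip E y\<close> continuous for the
  module norm, as needed for completeness of an orthogonal complement.\<close>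

lemma mod_norm_eq: "x \<in> carrier E \<Longrightarrow> mod_norm E x = norm (L x)"
proof -
  assume x: "x \<in> carrier E"
  have sq: "(norm (L x g))\<^sup>2 = Re (cinner g (ip E x x g))" for g
    by (simp add: cinner_L x flip: Re_cinner_self)
  have "norm (L x) \<le> mod_norm E x"
  proof (rule norm_blinfun_bound)
    fix g
    have "(norm (L x g))\<^sup>2 \<le> norm g * (norm (ip E x x) * norm g)"
      unfolding sq
      by (intro order_trans[OF complex_Re_le_cmod] order_trans[OF cinner_Cauchy_Schwarz]
          mult_left_mono norm_blinfun norm_ge_zero)
    also have "\<dots> = (mod_norm E x * norm g)\<^sup>2"
      by (simp add: mod_norm_def power_mult_distrib power2_eq_square[of "norm g"])
    finally show "norm (L x g) \<le> mod_norm E x * norm g"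
      by (rule power2_le_imp_le) (simp add: mod_norm_def)
  qed (simp add: mod_norm_def)
  moreover have "mod_norm E x \<le> norm (L x)"
    using norm_ip_le[of x x] x unfolding mod_norm_def
    by (intro real_le_lsqrt) (simp_all add: power2_eq_square)
  ultimately show ?thesis by simp
qed

text \<open>\<open>E\<^sub>0\<close> is the right submodule of all \<open>w\<close> for which \<open>adj (L w) o\<^sub>L T\<close> lies in \<open>B\<close>.  For \<open>w \<in> E\<^sub>0\<close>
  the operators \<open>L w o\<^sub>L adj (L w)\<close> map both the closed span of the families \<open>(L v g)\<^sub>g\<close>, \<open>v \<in> E\<^sub>0\<close>, and the
  family \<open>(T g)\<^sub>g\<close> into this closed span; being self-adjoint, they annihilate the difference between
  \<open>(T g)\<^sub>g\<close> and its projection to the closed span.\<close>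

lemma in_range_L_if_strongly_approximable:
  fixes T :: "'g \<Rightarrow>\<^sub>L 'h"
  defines "E\<^sub>0 \<equiv> {w \<in> carrier E. \<exists>d\<in>B. \<forall>f g. cinner (L w f) (T g) = cinner f (d g)}"
  assumes cl: "closedin (subtopology strong_operator_topology (ops_into (tensor_space E L)))
      (L ` carrier E)"
    and T: "clinear_op T"
    and range: "\<And>g. T g \<in> closure (span {L w f | w f. w \<in> E\<^sub>0})"
  shows "T \<in> L ` carrier E"
proof (rule strong_operator_closedD[OF cl])
  have "span {L w f | w f. w \<in> E\<^sub>0} \<subseteq> span {L w f | w f. w \<in> carrier E}"
    by (rule span_mono) (auto simp: E\<^sub>0_def)
  then show "T \<in> ops_into (tensor_space E L)"
    using T range closure_mono[of "span {L w f | w f. w \<in> E\<^sub>0}"]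
    unfolding ops_into_def tensor_space_def by blast
  fix I :: "'g set" assume I: "finite I"
  have E\<^sub>0D: "w \<in> carrier E" if "w \<in> E\<^sub>0" for w using that by (simp add: E\<^sub>0_def)
  have zero: "0 \<in> E\<^sub>0"
    using L_scaleC[OF zero_closed, of 0] by (auto simp: E\<^sub>0_def zero_closed intro!: bexI[OF _ alg.zero_closed])
  have add: "u + v \<in> E\<^sub>0" if u: "u \<in> E\<^sub>0" and v: "v \<in> E\<^sub>0" for u v
  proof -
    obtain d d' where "d \<in> B" "\<And>f g. cinner (L u f) (T g) = cinner f (d g)"
      "d' \<in> B" "\<And>f g. cinner (L v f) (T g) = cinner f (d' g)"
      using u v by (auto simp: E\<^sub>0_def)
    then show ?thesis using E\<^sub>0D[OF u] E\<^sub>0D[OF v]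
      by (auto simp: E\<^sub>0_def add_closed L_add cinner_add_left cinner_add_right blinfun.add_left
          intro!: bexI[of _ "d + d'"] alg.add_closed)
  qed
  have scale: "c *\<^sub>C u \<in> E\<^sub>0" if u: "u \<in> E\<^sub>0" for c u
  proof -
    obtain d where "d \<in> B" "\<And>f g. cinner (L u f) (T g) = cinner f (d g)"
      using u by (auto simp: E\<^sub>0_def)
    then show ?thesis using E\<^sub>0D[OF u]
      by (auto simp: E\<^sub>0_def scaleC_closed L_scaleC cinner_scaleC_left cinner_scaleC_right
          intro!: bexI[of _ "cnj c *\<^sub>C d"] alg.scaleC_closed)
  qed
  have ract: "ract E u b \<in> E\<^sub>0" if u: "u \<in> E\<^sub>0" and b: "b \<in> B" for u b
  proof -
    obtain d where "d \<in> B" "\<And>f g. cinner (L u f) (T g) = cinner f (d g)"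
      using u by (auto simp: E\<^sub>0_def)
    then show ?thesis using E\<^sub>0D[OF u] b
      by (auto simp: E\<^sub>0_def ract_closed L_ract alg.adj_right alg.adj_closed
          intro!: bexI[of _ "adj b o\<^sub>L d"] alg.compose_closed)
  qed
  \<comment> \<open>One sequence has to serve all \<open>g \<in> I\<close> at once. So the family of
    the \<open>T g\<close> is projected as a whole, in the direct sum over \<open>I\<close>, to the
    closure of the families of the \<open>L w g\<close> with
    \<open>w \<in> E\<^sub>0\<close>.\<close>
  obtain q s where s: "\<And>n. s n \<in> E\<^sub>0" and lim: "\<And>g. g \<in> I \<Longrightarrow> (\<lambda>n::nat. L (s n) g) \<longlonglongrightarrow> q g"
    and q: "\<And>w. w \<in> E\<^sub>0 \<Longrightarrow> (\<Sum>g\<in>I. cinner (q g) (L w g)) = (\<Sum>g\<in>I. cinner (T g) (L w g))"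
  proof (rule riesz_family[OF zero add scale, of I "\<lambda>g w. L w g"
        "\<lambda>w. \<Sum>g\<in>I. cinner (T g) (L w g)" "\<Sum>g\<in>I. (norm (T g))\<^sup>2"])
    fix w assume "w \<in> E\<^sub>0"
    have "cmod (\<Sum>g\<in>I. cinner (T g) (L w g)) \<le> (\<Sum>g\<in>I. norm (T g) * norm (L w g))"
      by (intro sum_norm_le cinner_Cauchy_Schwarz)
    then have "(cmod (\<Sum>g\<in>I. cinner (T g) (L w g)))\<^sup>2 \<le> (\<Sum>g\<in>I. norm (T g) * norm (L w g))\<^sup>2"
      by (rule power_mono) simp
    also have "\<dots> \<le> (\<Sum>g\<in>I. (norm (T g))\<^sup>2) * (\<Sum>g\<in>I. (norm (L w g))\<^sup>2)"
      by (rule Cauchy_Schwarz_ineq_sum)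
    finally show "(cmod (\<Sum>g\<in>I. cinner (T g) (L w g)))\<^sup>2
        \<le> (\<Sum>g\<in>I. (norm (T g))\<^sup>2) * (\<Sum>g\<in>I. (norm (L w g))\<^sup>2)" .
  qed (auto simp: L_add L_scaleC E\<^sub>0D cinner_add_right cinner_scaleC_right sum.distrib
      sum_distrib_left I)
  define h where "h g = T g - q g" for g
  have h: "(\<Sum>g\<in>I. cinner (h g) (L w g)) = 0" if "w \<in> E\<^sub>0" for w
    using q[OF that] by (simp add: h_def cinner_diff_left sum_subtractf)
  have ann: "adj (L w) (h g) = 0" if w: "w \<in> E\<^sub>0" and g: "g \<in> I" for w g
  proof -
    define A where "A = adj (L w)"
    have A: "cinner f (A k) = cinner (L w f) k" for f k
      by (simp add: A_def cinner_adj_right clinear_L E\<^sub>0D w)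
    obtain d where d: "d \<in> B" "\<And>f g. cinner (L w f) (T g) = cinner f (d g)"
      using w by (auto simp: E\<^sub>0_def)
    have AT: "A (T g) = d g" for g by (rule cinner_ext) (simp add: A d)
    \<comment> \<open>As \<open>d\<close> represents \<open>adj (L w) o\<^sub>L T\<close>, the
      vectors \<open>L (u n) g\<close> tend to \<open>L w (adj (L w) (h g))\<close>. These form a
      family in the closed span, to which \<open>h\<close> is orthogonal; the pairing is the sum of
      the squared norms of \<open>adj (L w) (h g)\<close>.\<close>
    define u where "u n = ract E w (d + (-1) *\<^sub>C ip E w (s n))" for n
    have ip_B: "ip E w (s n) \<in> B" for n by (simp add: ip_closed E\<^sub>0D w s)
    have dB: "d + (-1) *\<^sub>C ip E w (s n) \<in> B" for n
      by (intro alg.add_closed alg.scaleC_closed d ip_B)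
    have u: "u n \<in> E\<^sub>0" for n unfolding u_def by (rule ract[OF w dB])
    have Lu: "L (u n) g = L w (A (T g - L (s n) g))" for n g
      unfolding u_def L_ract[OF E\<^sub>0D[OF w] dB]
      by (simp add: blinfun.diff_right
          blinfun.diff_left scaleC_minus1 AT adj_L_L[OF E\<^sub>0D[OF w] E\<^sub>0D[OF s], folded A_def])
    have "(\<lambda>n. \<Sum>g\<in>I. cinner (h g) (L (u n) g)) \<longlonglongrightarrow> (\<Sum>g\<in>I. cinner (h g) (L w (A (h g))))"
      unfolding Lu h_def by (intro tendsto_intros lim)
    then have "(\<Sum>g\<in>I. cinner (h g) (L w (A (h g)))) = 0"
      by (simp add: h u LIMSEQ_const_iff)
    moreover have "cinner (h g) (L w (A (h g))) = cinner (A (h g)) (A (h g))" for g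
      by (subst cinner_commute) (simp add: cinner_self flip: A)
    ultimately have "(\<Sum>g\<in>I. cinner (A (h g)) (A (h g))) = 0" by simp
    then have "complex_of_real (\<Sum>g\<in>I. (norm (A (h g)))\<^sup>2) = 0"
      by (simp only: cinner_self of_real_sum)
    then have "(\<Sum>g\<in>I. (norm (A (h g)))\<^sup>2) = 0" by (simp only: of_real_eq_0_iff)
    then have "\<forall>g\<in>I. (norm (A (h g)))\<^sup>2 = 0" using I by (simp add: sum_nonneg_eq_0_iff)
    then show ?thesis using g by (simp add: A_def)
  qed
  have "q g = T g" if g: "g \<in> I" for g
  proof -
    \<comment> \<open>Orthogonality of whole families has become orthogonality of the single vector
      \<open>h g\<close> to \<open>L w f\<close> with arbitrary \<open>f\<close>, which is what the
      hypothesis on the values of \<open>T\<close> requires.\<close>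
    have perp: "cinner (h g) (L w f) = 0" if "w \<in> E\<^sub>0" for w f
    proof -
      have "cinner (L w f) (h g) = cinner f (adj (L w) (h g))"
        by (simp add: cinner_adj_right clinear_L E\<^sub>0D that)
      then show ?thesis by (subst cinner_commute) (simp add: ann[OF that g])
    qed
    have "cinner (h g) (T g) = 0"
      by (rule cinner_closure_span_eq_zero[OF range]) (use perp in auto)
    moreover have "(\<lambda>n. cinner (h g) (L (s n) g)) \<longlonglongrightarrow> cinner (h g) (q g)"
      by (intro tendsto_intros lim g)
    then have "cinner (h g) (q g) = 0" by (simp add: perp s LIMSEQ_const_iff)
    ultimately have "cinner (h g) (h g) = 0" by (simp add: h_def cinner_diff_right)
    then show ?thesis by (simp add: h_def)
  qed
  with s lim E\<^sub>0D show "\<exists>S. (\<forall>n. S n \<in> L ` carrier E) \<and> (\<forall>g\<in>I. (\<lambda>n::nat. blinfun_apply (S n) g) \<longlonglongrightarrow> T g)"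
    by (intro exI[of _ "\<lambda>n. L (s n)"]) auto
qed

end

section \<open>Vectors commuting with the algebra\<close>

text \<open>Invariance under scalars absorbs the coefficients, so a domination stated for plain sums
  covers the whole span.\<close>

lemma span_as_finite_sum:
  fixes X :: "'v::real_vector set"
  assumes "p \<in> span X" and scale: "\<And>r x. x \<in> X \<Longrightarrow> r *\<^sub>R x \<in> X"
  obtains n :: nat and q where "\<And>i. i < n \<Longrightarrow> q i \<in> X" "p = (\<Sum>i<n. q i)"
proof -
  have "\<exists>(n::nat) q. (\<forall>i<n. q i \<in> X) \<and> p = (\<Sum>i<n. q i)"
    using assms(1)
  proof (induction rule: span_induct_alt)
    case base
    show ?case by (rule exI[of _ 0]) simp
  next
    case (step r x p)
    then obtain n :: nat and q where "\<forall>i<n. q i \<in> X" "p = (\<Sum>i<n. q i)" by blast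
    then show ?case using scale[OF step(1), of r]
      by (intro exI[of _ "Suc n"] exI[of _ "q(n := r *\<^sub>R x)"]) (auto simp: less_Suc_eq)
  qed
  then show thesis using that by blast
qed

lemma fst_scaleC: "fst (c *\<^sub>C p) = c *\<^sub>C fst p"
  and snd_scaleC: "snd (c *\<^sub>C p) = c *\<^sub>C snd p"
  by (simp_all add: scaleC_prod_def)

locale vn_bimodule = embedded_module B E L + vn_correspondence B E
  for B :: "('g::complex_hilbert_space \<Rightarrow>\<^sub>L 'g) set"
    and E :: "('e::complex_vector, 'g \<Rightarrow>\<^sub>L 'g, 'g \<Rightarrow>\<^sub>L 'g) bimodule"
    and L :: "'e \<Rightarrow> 'g \<Rightarrow>\<^sub>L 'h::complex_hilbert_space" +
  assumes strongly_closed: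
    "closedin (subtopology strong_operator_topology (ops_into (tensor_space E L))) (L ` carrier E)"
begin

text \<open>Under the domination hypothesis \<open>L (a x) f \<mapsto> a c f\<close> extends to a contraction, whose adjoint
  turns out to be \<open>L z\<close>.\<close>

lemma dominated_functional_represented:
  assumes x: "x \<in> carrier E" and c: "c \<in> B"
    and dom: "\<And>n a f. (\<And>i. i < n \<Longrightarrow> a i \<in> B) \<Longrightarrow>
      norm (\<Sum>i<n::nat. blinfun_apply (a i) (c (f i))) \<le> norm (\<Sum>i<n. L (lact E (a i) x) (f i))"
  obtains z where "z \<in> carrier E" "\<And>a. a \<in> B \<Longrightarrow> ip E (lact E a x) z = adj (a o\<^sub>L c)"
    "\<And>g. L z g \<in> closure (span {L (lact E a x) f | a f. a \<in> B})"
proof -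
  define X where "X = {L (lact E a x) f | a f. a \<in> B}"
  \<comment> \<open>\<open>Y\<close> spans the graph of the prospective contraction. Working on the
    graph avoids choosing preimages: \<open>contr\<close> contains both well-definedness and the
    norm bound.\<close>
  define Y where "Y = {(L (lact E a x) f, blinfun_apply a (c f)) | a f. a \<in> B}"
  have ax: "lact E a x \<in> carrier E" if "a \<in> B" for a by (simp add: lact_closed x that)
  have Y_scaleC: "s *\<^sub>C p \<in> Y" if p: "p \<in> Y" for s p
  proof -
    obtain a f where "a \<in> B" "p = (L (lact E a x) f, a (c f))" using p by (auto simp: Y_def)
    then show ?thesis
      by (auto simp: Y_def scaleC_prod_def clinear_opD[OF clinear_L] ax
          clinear_opD[OF alg.clinear] c intro!: exI[of _ a] exI[of _ "s *\<^sub>C f"])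
  qed
  have span_scaleC: "s *\<^sub>C p \<in> span Y" if "p \<in> span Y" for s p
    using that
  proof (induction rule: span_induct_alt)
    case (step r q p)
    have "s *\<^sub>C r *\<^sub>R q = r *\<^sub>R s *\<^sub>C q" by (simp add: scaleR_scaleC scaleC_scaleC mult.commute)
    then show ?case using step
      by (simp add: scaleC_add_right span_add span_scale span_base Y_scaleC)
  qed (simp add: span_zero)
  have fst_span: "fst p \<in> span X" if "p \<in> span Y" for p
    using that
  proof (induction rule: span_induct_alt)
    case (step r q p)
    have "fst q \<in> X" using step(1) unfolding X_def Y_def by force
    then show ?case using step by (simp add: span_add span_scale span_base)
  qed (simp add: span_zero)
  have contr: "norm (snd p) \<le> norm (fst p)" if p: "p \<in> span Y" for p
  proof -
    have "r *\<^sub>R q \<in> Y" if "q \<in> Y" for r q using Y_scaleC[OF that] by (simp add: scaleR_scaleC)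
    from span_as_finite_sum[OF p this]
    obtain n :: nat and q where q: "\<And>i. i < n \<Longrightarrow> q i \<in> Y" "p = (\<Sum>i<n. q i)"
      by blast
    have "\<forall>i. \<exists>a f. i < n \<longrightarrow> a \<in> B \<and> q i = (L (lact E a x) f, blinfun_apply a (c f))"
      using q(1) unfolding Y_def by blast
    then obtain a f where af: "\<And>i. i < n \<Longrightarrow> a i \<in> B"
      "\<And>i. i < n \<Longrightarrow> q i = (L (lact E (a i) x) (f i), blinfun_apply (a i) (c (f i)))"
      by metis
    show ?thesis using dom[where n = n and a = a and f = f, OF af(1)] by (simp add: q(2) fst_sum snd_sum af(2))
  qed
  \<comment> \<open>\<open>t\<close> is the value at \<open>g\<close> of the adjoint of the
    contraction: it represents the functional \<open>p \<mapsto> cinner g (snd p)\<close>, which is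
    bounded by the norm of the first component.\<close>
  have "\<exists>t. t \<in> closure (span X) \<and> norm t \<le> norm g
      \<and> (\<forall>a\<in>B. \<forall>f. cinner (L (lact E a x) f) t = cinner (blinfun_apply a (c f)) g)" for g
  proof -
    obtain q s where s: "\<And>n. s n \<in> span Y"
      and lim: "\<And>i. i \<in> {()} \<Longrightarrow> (\<lambda>n::nat. fst (s n)) \<longlonglongrightarrow> q i"
      and q: "\<And>p. p \<in> span Y \<Longrightarrow> (\<Sum>i\<in>{()}. cinner (q i) (fst p)) = cinner g (snd p)"
    proof (rule riesz_family[of "span Y" "{()}" "\<lambda>_. fst" "\<lambda>p. cinner g (snd p)" "(norm g)\<^sup>2"])
      fix p assume "p \<in> span Y"
      then have "cmod (cinner g (snd p)) \<le> norm g * norm (fst p)"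
        by (intro order_trans[OF cinner_Cauchy_Schwarz] mult_left_mono contr) auto
      then show "(cmod (cinner g (snd p)))\<^sup>2 \<le> (norm g)\<^sup>2 * (\<Sum>i\<in>{()}. (norm (fst p))\<^sup>2)"
        using power_mono[of _ "norm g * norm (fst p)" 2] by (simp add: power_mult_distrib)
    qed (simp_all add: span_zero span_add span_scaleC fst_scaleC snd_scaleC cinner_add_right
        cinner_scaleC_right, blast)
    define t where "t = q ()"
    have lim: "(\<lambda>n. fst (s n)) \<longlonglongrightarrow> t" and t: "\<And>p. p \<in> span Y \<Longrightarrow> cinner t (fst p) = cinner g (snd p)"
      using lim q by (simp_all add: t_def)
    have "t \<in> closure (span X)"
      using fst_span[OF s] lim unfolding closure_sequential
      by (intro exI[of _ "\<lambda>n. fst (s n)"]) auto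
    \<comment> \<open>Along the approximating sequence, whose first components tend to
      \<open>t\<close>, the bound on the functional becomes a bound on \<open>t\<close>.\<close>
    moreover have "norm t \<le> norm g"
    proof -
      have "(\<lambda>n. cmod (cinner t (fst (s n)))) \<longlonglongrightarrow> cmod (cinner t t)"
        by (intro tendsto_intros lim)
      moreover have "(\<lambda>n. norm g * norm (fst (s n))) \<longlonglongrightarrow> norm g * norm t"
        by (intro tendsto_intros lim)
      moreover have "cmod (cinner t (fst (s n))) \<le> norm g * norm (fst (s n))" for n
        unfolding t[OF s]
        by (intro order_trans[OF cinner_Cauchy_Schwarz] mult_left_mono contr s) auto
      ultimately have "cmod (cinner t t) \<le> norm g * norm t"
        by (blast intro: LIMSEQ_le)
      then show ?thesis by (cases "t = 0") (simp_all add: cinner_self norm_mult power2_eq_square)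
    qed
    moreover have "cinner (L (lact E a x) f) t = cinner (blinfun_apply a (c f)) g" if "a \<in> B" for a f
    proof -
      have "(L (lact E a x) f, blinfun_apply a (c f)) \<in> span Y"
        by (rule span_base) (use that in \<open>auto simp: Y_def\<close>)
      from t[OF this] show ?thesis
        by (subst (1 2) cinner_commute) simp
    qed
    ultimately show ?thesis by blast
  qed
  then obtain t where t_closure: "\<And>g. t g \<in> closure (span X)" and t_norm: "\<And>g. norm (t g) \<le> norm g"
    and t: "\<And>g a f. a \<in> B \<Longrightarrow> cinner (L (lact E a x) f) (t g) = cinner (blinfun_apply a (c f)) g"
    by metis
  \<comment> \<open>Values of \<open>t\<close> lie in the closed span of \<open>X\<close>, so inner
    products with \<open>X\<close> determine them; linearity of \<open>t\<close> follows from
    this.\<close>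
  have t_eqI: "cinner h (t g) = 0" if "\<And>a f. a \<in> B \<Longrightarrow> cinner h (L (lact E a x) f) = 0" for h g
    by (rule cinner_closure_span_eq_zero[OF t_closure]) (use that in \<open>auto simp: X_def\<close>)
  have t': "cinner (t g) (L (lact E a x) f) = cinner g (blinfun_apply a (c f))" if "a \<in> B" for g a f
    using t[OF that, of f g] by (metis cinner_commute)
  have t_add: "t (g + g') = t g + t g'" for g g'
  proof -
    define h where "h = t (g + g') - (t g + t g')"
    have "cinner h (t k) = 0" for k
      by (rule t_eqI) (simp add: h_def cinner_diff_left cinner_add_left t')
    then have "cinner h h = 0" by (subst (2) h_def) (simp add: cinner_diff_right cinner_add_right)
    then show ?thesis by (simp add: h_def)
  qed
  have t_scaleC: "t (s *\<^sub>C g) = s *\<^sub>C t g" for s g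
  proof -
    define h where "h = t (s *\<^sub>C g) - s *\<^sub>C t g"
    have "cinner h (t k) = 0" for k
      by (rule t_eqI) (simp add: h_def cinner_diff_left cinner_scaleC_left t')
    then have "cinner h h = 0" by (subst (2) h_def) (simp add: cinner_diff_right cinner_scaleC_right)
    then show ?thesis by (simp add: h_def)
  qed
  define T where "T = Blinfun t"
  have "bounded_linear t"
    by (rule bounded_linear_intro[where K = 1]) (simp_all add: t_add t_scaleC t_norm scaleR_scaleC)
  then have T: "blinfun_apply T = t" by (simp add: T_def bounded_linear_Blinfun_apply)
  have "T \<in> L ` carrier E"
  proof (rule in_range_L_if_strongly_approximable[OF strongly_closed])
    show "clinear_op T" by (simp add: clinear_op_def T t_scaleC)
    \<comment> \<open>Every \<open>a x\<close> satisfies the membership condition of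
      \<open>in_range_L_if_strongly_approximable\<close>, with \<open>adj (a o\<^sub>L c)\<close> as
      the element of \<open>B\<close>.\<close>
    have "\<exists>d\<in>B. \<forall>f g. cinner (L (lact E a x) f) (T g) = cinner f (d g)" if a: "a \<in> B" for a
      by (rule bexI[of _ "adj (a o\<^sub>L c)"])
        (simp_all add: T t a alg.adj_right alg.adj_closed alg.compose_closed c)
    then have "X \<subseteq> {L w f | w f. w \<in> {w \<in> carrier E. \<exists>d\<in>B. \<forall>f g. cinner (L w f) (T g) = cinner f (d g)}}"
      using ax unfolding X_def by blast
    then show "T g \<in> closure (span {L w f | w f. w \<in> {w \<in> carrier E. \<exists>d\<in>B. \<forall>f g. cinner (L w f) (T g) = cinner f (d g)}})" for g
      unfolding T using t_closure[of g] closure_mono[OF span_mono] by blast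
  qed
  then obtain z where z: "z \<in> carrier E" "T = L z" by blast
  show thesis
  proof
    show "ip E (lact E a x) z = adj (a o\<^sub>L c)" if a: "a \<in> B" for a
    proof (rule blinfun_eq_cinnerI)
      fix f g
      have "cinner f (ip E (lact E a x) z g) = cinner (L (lact E a x) f) (T g)"
        by (simp add: z cinner_L ax a)
      also have "\<dots> = cinner f (adj (a o\<^sub>L c) g)"
        by (simp add: T t a alg.adj_right alg.compose_closed c)
      finally show "cinner f (ip E (lact E a x) z g) = cinner f (adj (a o\<^sub>L c) g)" .
    qed
    show "L z g \<in> closure (span {L (lact E a x) f | a f. a \<in> B})" for g
      using t_closure[of g] by (simp add: X_def T flip: z(2))
  qed (rule z)
qed

text \<open>Both \<open>b z\<close> and \<open>z b\<close> have the same inner products with all \<open>a x\<close>, and \<open>z\<close> is a limit of combinations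
  of the \<open>a x b'\<close>.\<close>

lemma central_vector_exists:
  assumes x: "x \<in> carrier E" and c: "c \<in> B"
    and dom: "\<And>n a f. (\<And>i. i < n \<Longrightarrow> a i \<in> B) \<Longrightarrow>
      norm (\<Sum>i<n::nat. blinfun_apply (a i) (c (f i))) \<le> norm (\<Sum>i<n. L (lact E (a i) x) (f i))"
  obtains z where "z \<in> carrier E" "ip E x z = adj c" "\<And>b. b \<in> B \<Longrightarrow> lact E b z = ract E z b"
proof -
  obtain z where z: "z \<in> carrier E" and xz: "\<And>a. a \<in> B \<Longrightarrow> ip E (lact E a x) z = adj (a o\<^sub>L c)"
    and z_closure: "\<And>g. L z g \<in> closure (span {L (lact E a x) f | a f. a \<in> B})"
    using dominated_functional_represented[OF x c dom] by blast
  have ax: "lact E a x \<in> carrier E" if "a \<in> B" for a by (simp add: lact_closed x that)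
  have perp: "ip E u z = 0" if u: "u \<in> carrier E" and ux: "\<And>a. a \<in> B \<Longrightarrow> ip E (lact E a x) u = 0" for u
  proof (rule blinfun_eq_cinnerI)
    fix f g
    have "cinner (L u f) (L z g) = 0"
    proof (rule cinner_closure_span_eq_zero[OF z_closure])
      fix k assume "k \<in> {L (lact E a x) f | a f. a \<in> B}"
      then obtain a h where a: "a \<in> B" "k = L (lact E a x) h" by blast
      then show "cinner (L u f) k = 0"
        by (simp add: cinner_L u ax cinner_ip[OF u ax[OF a(1)]] ux)
    qed
    then show "cinner f (ip E u z g) = cinner f (blinfun_apply 0 g)" by (simp add: cinner_L u z)
  qed
  have "lact E b z = ract E z b" if b: "b \<in> B" for b
  proof -
    define v where "v = lact E b z - ract E z b"
    have bz: "lact E b z \<in> carrier E" and zb: "ract E z b \<in> carrier E"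
      by (simp_all add: lact_closed ract_closed z b)
    have v: "v \<in> carrier E" unfolding v_def by (rule diff_closed[OF bz zb])
    have xv: "ip E (lact E a x) v = 0" if a: "a \<in> B" for a
    proof -
      have "ip E (lact E a x) (lact E b z) = ip E (lact E (adj b o\<^sub>L a) x) z"
        using lact_adj[OF alg.adj_closed[OF b] ax[OF a] z]
        by (simp add: lact_compose alg.adj_closed alg.adj_involution a b x)
      also have "\<dots> = adj (a o\<^sub>L c) o\<^sub>L b"
        by (rule blinfun_eq_cinnerI)
          (simp add: xz alg.adj_closed alg.compose_closed a b c alg.adj_right alg.adj_left)
      also have "\<dots> = ip E (lact E a x) (ract E z b)"
        by (simp add: ip_ract_right ax a z b xz)
      finally show ?thesis by (simp add: v_def ip_diff_right ax a bz zb)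
    qed
    \<comment> \<open>Orthogonality to all \<open>a x\<close> passes from \<open>v\<close> to
      \<open>adj b\<close> acting on \<open>v\<close>, because \<open>b (a x)\<close> is again of
      the form \<open>a x\<close>. So \<open>perp\<close> removes \<open>b z\<close> as well as
      \<open>z b\<close> from the inner square of \<open>v\<close>.\<close>
    have bv: "lact E (adj b) v \<in> carrier E" by (simp add: lact_closed alg.adj_closed b v)
    have "ip E (lact E a x) (lact E (adj b) v) = 0" if a: "a \<in> B" for a
      using lact_adj[OF b ax[OF a] v] xv[of "b o\<^sub>L a"] by (simp add: lact_compose alg.compose_closed a b x)
    from perp[OF bv this] have "ip E v (lact E b z) = 0"
      using lact_adj[OF alg.adj_closed[OF b] v z] by (simp add: alg.adj_involution b)
    moreover have "ip E v (ract E z b) = 0"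
      by (simp add: ip_ract_right v z b perp[OF v xv] blinfun_eq_iff)
    ultimately have "ip E v v = 0"
      using ip_diff_right[OF v bz zb] by (simp flip: v_def)
    then show ?thesis using ip_definite[OF v] by (simp add: v_def)
  qed
  moreover have "ip E x z = adj c" using xz[OF alg.one_closed] by (simp add: lact_one x)
  ultimately show thesis using that z by blast
qed

end

section \<open>Inverse square roots\<close>

text \<open>Polarisation with \<open>f\<close> the multiple of \<open>T g\<close> of the same norm
  as \<open>g\<close>: \<open>4 * Re (cinner f (T g))\<close> is a difference of two values of the
  quadratic form, and the parallelogram law adds up their bounds.\<close>

lemma symmetric_norm_le:
  fixes T :: "'g::complex_hilbert_space \<Rightarrow>\<^sub>L 'g"
  assumes sym: "\<And>f g. cinner (T f) g = cinner f (T g)"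
    and m: "\<And>g. \<bar>Re (cinner g (T g))\<bar> \<le> m * (norm g)\<^sup>2" "m \<ge> 0"
  shows "norm T \<le> m"
proof (rule norm_blinfun_bound)
  fix g
  show "norm (T g) \<le> m * norm g"
  proof (cases "T g = 0")
    case False
    then have g: "norm g > 0" and Tg: "norm (T g) > 0" by auto
    define t where "t = norm g / norm (T g)"
    define f where "f = t *\<^sub>R T g"
    have t: "t > 0" using g Tg by (simp add: t_def)
    have norm_f: "norm f = norm g" using Tg by (simp add: f_def t_def)
    have "Re (cinner f (T g)) = Re (cinner (T f) g)" by (simp add: sym)
    then have comm: "Re (cinner f (T g)) = Re (cinner g (T f))"
      by (subst (2) cinner_commute) simp
    have par: "(norm (f + g))\<^sup>2 + (norm (f - g))\<^sup>2 = 4 * (norm g)\<^sup>2"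
      using norm_add_sq[of f g] norm_add_sq[of f "- g"] by (simp add: norm_f cinner_minus_right)
    have "4 * Re (cinner f (T g))
        = Re (cinner (f + g) (T (f + g))) - Re (cinner (f - g) (T (f - g)))"
      by (simp add: blinfun.add_right blinfun.diff_right cinner_add_left cinner_add_right
          cinner_diff_left cinner_diff_right comm)
    also have "\<dots> \<le> m * (norm (f + g))\<^sup>2 + m * (norm (f - g))\<^sup>2"
      using m(1)[of "f + g"] m(1)[of "f - g"] by linarith
    also have "\<dots> = 4 * (m * (norm g)\<^sup>2)" using par by (simp flip: distrib_left)
    finally have "Re (cinner f (T g)) \<le> m * (norm g)\<^sup>2" by simp
    moreover have "Re (cinner f (T g)) = norm g * norm (T g)"
      using Tg by (simp add: f_def t_def bounded_bilinear.scaleR_left[OF bounded_bilinear_cinner]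
          Re_cinner_self power2_eq_square)
    ultimately show ?thesis using g by (simp add: power2_eq_square)
  qed (simp add: m)
qed (rule m)

context vn_algebra
begin

lemma scaleR_closed: "b \<in> B \<Longrightarrow> r *\<^sub>R b \<in> B"
  using scaleC_closed[of b "complex_of_real r"] by (simp add: scaleR_scaleC)

text \<open>Symmetry is written with \<open>cinner\<close>, a condition visibly closed in norm.
  Since the elements commute, products stay symmetric, so both fixed-point maps below preserve this
  set.\<close>

definition central_selfadjoint :: "('g \<Rightarrow>\<^sub>L 'g) set" where
  "central_selfadjoint =
    {r \<in> B. (\<forall>b\<in>B. r o\<^sub>L b = b o\<^sub>L r) \<and> (\<forall>f g. cinner (r f) g = cinner f (r g))}"

lemma central_selfadjointI:
  "\<lbrakk>r \<in> B; \<And>b. b \<in> B \<Longrightarrow> r o\<^sub>L b = b o\<^sub>L r; \<And>f g. cinner (r f) g = cinner f (r g)\<rbrakk>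
    \<Longrightarrow> r \<in> central_selfadjoint"
  by (simp add: central_selfadjoint_def)

lemma central_selfadjointD:
  assumes "r \<in> central_selfadjoint"
  shows "r \<in> B" "b \<in> B \<Longrightarrow> r (b g) = b (r g)" "cinner (r f) g = cinner f (r g)"
  using assms by (auto simp: central_selfadjoint_def blinfun_eq_iff)

lemma closed_central_selfadjoint: "closed central_selfadjoint"
proof -
  have "central_selfadjoint = B \<inter> (\<Inter>b\<in>B. {r. r o\<^sub>L b = b o\<^sub>L r})
      \<inter> (\<Inter>f. \<Inter>g. {r. cinner (blinfun_apply r f) g = cinner f (blinfun_apply r g)})"
    by (auto simp: central_selfadjoint_def)
  moreover have "closed {r. r o\<^sub>L b = b o\<^sub>L r}" for b :: "'g \<Rightarrow>\<^sub>L 'g"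
    by (intro closed_Collect_eq continuous_intros
        bounded_bilinear.continuous_on[OF bounded_bilinear_blinfun_compose])
  moreover have "closed {r :: 'g \<Rightarrow>\<^sub>L 'g. cinner (r f) g = cinner f (r g)}" for f g
    by (intro closed_Collect_eq continuous_intros)
  ultimately show ?thesis by (auto intro!: closed_Int closed closed_INT)
qed

lemma central_selfadjoint_closed:
  "id_blinfun \<in> central_selfadjoint"
  "r \<in> central_selfadjoint \<Longrightarrow> k *\<^sub>R r \<in> central_selfadjoint"
  "\<lbrakk>r \<in> central_selfadjoint; r' \<in> central_selfadjoint\<rbrakk> \<Longrightarrow> r + r' \<in> central_selfadjoint"
  "\<lbrakk>r \<in> central_selfadjoint; r' \<in> central_selfadjoint\<rbrakk> \<Longrightarrow> r o\<^sub>L r' \<in> central_selfadjoint"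
proof -
  show "id_blinfun \<in> central_selfadjoint"
    by (rule central_selfadjointI) (simp_all add: one_closed)
  show "k *\<^sub>R r \<in> central_selfadjoint" if "r \<in> central_selfadjoint"
    using central_selfadjointD[OF that]
    by (intro central_selfadjointI scaleR_closed)
      (auto simp: blinfun_eq_iff blinfun.scaleR_left blinfun.scaleR_right
        bounded_bilinear.scaleR_left[OF bounded_bilinear_cinner]
        bounded_bilinear.scaleR_right[OF bounded_bilinear_cinner])
  assume r: "r \<in> central_selfadjoint" and r': "r' \<in> central_selfadjoint"
  note D = central_selfadjointD[OF r] central_selfadjointD[OF r']
  show "r + r' \<in> central_selfadjoint"
    by (intro central_selfadjointI add_closed)
      (simp_all add: blinfun_eq_iff blinfun.add_left blinfun.add_right cinner_add_left
        cinner_add_right D(1,3,4,6) D(2)[of b for b] D(5)[of b for b])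
  show "r o\<^sub>L r' \<in> central_selfadjoint"
  proof (rule central_selfadjointI)
    show "r o\<^sub>L r' \<in> B" by (rule compose_closed[OF D(1) D(4)])
    show "r o\<^sub>L r' o\<^sub>L b = b o\<^sub>L (r o\<^sub>L r')" if b: "b \<in> B" for b
      using D(2)[OF b] D(5)[OF b] by (simp add: blinfun_eq_iff)
    show "cinner ((r o\<^sub>L r') f) g = cinner f ((r o\<^sub>L r') g)" for f g
      by (simp add: D(3) D(6)) (simp only: D(2)[OF D(4)])
  qed
qed

text \<open>With \<open>a = 1 - p / K\<close>, the fixed point \<open>r\<close> of \<open>r \<mapsto> (a + r\<^sup>2) / 2\<close> satisfies \<open>(1 - r)\<^sup>2 = p / K\<close>, and
  the fixed point \<open>u\<close> of \<open>u \<mapsto> 1 + r u\<close> is the inverse of \<open>1 - r\<close>.\<close>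

lemma inverse_square_root:
  assumes p: "p \<in> central_selfadjoint" and lower: "\<And>g. \<epsilon> * (norm g)\<^sup>2 \<le> Re (cinner g (p g))"
    and \<epsilon>: "\<epsilon> > 0"
  obtains s where "s \<in> central_selfadjoint" "s o\<^sub>L p o\<^sub>L s = id_blinfun"
proof -
  \<comment> \<open>Scaling by \<open>K\<close> places the form of \<open>p / K\<close> between
    \<eta> and 1, whence \<open>norm a \<le> 1 - \<eta>\<close>; the summand \<epsilon> ensures
    \<open>K > 0\<close> and \<open>\<eta> \<le> 1\<close>.\<close>
  define K where "K = norm p + \<epsilon>"
  define \<eta> where "\<eta> = \<epsilon> / K"
  have K: "K > 0" using \<epsilon> by (simp add: K_def add_nonneg_pos)
  have \<eta>: "0 < \<eta>" "\<eta> \<le> 1" using \<epsilon> K by (simp_all add: \<eta>_def K_def)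
  define a where "a = id_blinfun + (- 1 / K) *\<^sub>R p"
  have a: "a \<in> central_selfadjoint"
    unfolding a_def by (intro central_selfadjoint_closed p)
  have norm_a: "norm a \<le> 1 - \<eta>"
  proof (rule symmetric_norm_le)
    fix g
    have eq: "Re (cinner g (a g)) = (norm g)\<^sup>2 - Re (cinner g (p g)) / K"
      by (simp add: a_def blinfun.diff_left blinfun.scaleR_left cinner_diff_right
          bounded_bilinear.scaleR_right[OF bounded_bilinear_cinner] Re_cinner_self)
    have "Re (cinner g (p g)) \<le> norm g * (norm p * norm g)"
      by (intro order_trans[OF complex_Re_le_cmod] order_trans[OF cinner_Cauchy_Schwarz]
          mult_left_mono norm_blinfun norm_ge_zero)
    also have "\<dots> \<le> K * (norm g)\<^sup>2"
      using \<epsilon> by (simp add: K_def power2_eq_square algebra_simps)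
    finally have "Re (cinner g (p g)) / K \<le> (norm g)\<^sup>2" using K by (simp add: field_simps)
    moreover have "\<eta> * (norm g)\<^sup>2 \<le> Re (cinner g (p g)) / K"
      using lower[of g] K by (simp add: \<eta>_def field_simps)
    moreover have "0 \<le> \<eta> * (norm g)\<^sup>2" using \<eta> by simp
    ultimately show "\<bar>Re (cinner g (a g))\<bar> \<le> (1 - \<eta>) * (norm g)\<^sup>2"
      unfolding eq by (simp add: algebra_simps)
  qed (use \<eta> central_selfadjointD[OF a] in auto)
  \<comment> \<open>The smaller root of \<open>(1 - \<eta>) + q * q = 2 * q\<close>: the ball of
    radius \<open>q\<close> is mapped to itself, and \<open>q\<close> is also the contraction
    constant.\<close>
  define q where "q = 1 - sqrt \<eta>"
  have q: "0 \<le> q" "q < 1" using \<eta> by (simp_all add: q_def)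
  have "\<exists>!r. r \<in> central_selfadjoint \<inter> cball 0 q \<and> (1/2) *\<^sub>R (a + (r o\<^sub>L r)) = r"
  proof (rule Banach_fix)
    show "complete (central_selfadjoint \<inter> cball 0 q)"
      by (simp add: complete_eq_closed closed_central_selfadjoint closed_Int)
    have "(0 :: real) *\<^sub>R a \<in> central_selfadjoint" by (rule central_selfadjoint_closed(2)[OF a])
    then show "central_selfadjoint \<inter> cball 0 q \<noteq> {}" using q by auto
    show "(\<lambda>r. (1/2) *\<^sub>R (a + (r o\<^sub>L r))) ` (central_selfadjoint \<inter> cball 0 q)
        \<subseteq> central_selfadjoint \<inter> cball 0 q"
    proof (intro image_subsetI IntI central_selfadjoint_closed a)
      fix r assume r: "r \<in> central_selfadjoint \<inter> cball 0 q"
      then have "norm (r o\<^sub>L r) \<le> q * q"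
        using q by (intro order_trans[OF norm_blinfun_compose] mult_mono) auto
      then have "norm (a + (r o\<^sub>L r)) \<le> (1 - \<eta>) + q * q"
        using norm_a norm_triangle_ineq[of a "r o\<^sub>L r"] by linarith
      also have "\<dots> = 2 * q" using \<eta> by (simp add: q_def algebra_simps)
      finally show "(1/2) *\<^sub>R (a + (r o\<^sub>L r)) \<in> cball 0 q" by simp
    qed auto
    fix r r' assume "r \<in> central_selfadjoint \<inter> cball 0 q" "r' \<in> central_selfadjoint \<inter> cball 0 q"
    then have r: "norm r \<le> q" "norm r' \<le> q" by auto
    have "(1/2) *\<^sub>R (a + (r o\<^sub>L r)) - (1/2) *\<^sub>R (a + (r' o\<^sub>L r'))
        = (1/2) *\<^sub>R ((r o\<^sub>L (r - r')) + ((r - r') o\<^sub>L r'))"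
      by (simp add: blinfun_eq_iff blinfun.add_left blinfun.diff_left blinfun.scaleR_left
          blinfun.diff_right algebra_simps)
    then have "dist ((1/2) *\<^sub>R (a + (r o\<^sub>L r))) ((1/2) *\<^sub>R (a + (r' o\<^sub>L r')))
        \<le> (norm r * norm (r - r') + norm (r - r') * norm r') / 2"
      using norm_triangle_mono[OF norm_blinfun_compose[of r "r - r'"] norm_blinfun_compose[of "r - r'" r']]
      by (simp add: dist_norm)
    also have "\<dots> \<le> (q * norm (r - r') + norm (r - r') * q) / 2"
      by (intro divide_right_mono add_mono mult_left_mono mult_right_mono r) auto
    finally show "dist ((1/2) *\<^sub>R (a + (r o\<^sub>L r))) ((1/2) *\<^sub>R (a + (r' o\<^sub>L r'))) \<le> q * dist r r'"
      by (simp add: dist_norm)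
  qed (use q in auto)
  from ex1_implies_ex[OF this]
  obtain r where r: "r \<in> central_selfadjoint" "norm r \<le> q" and fix_r: "(1/2) *\<^sub>R (a + (r o\<^sub>L r)) = r"
    by auto
  \<comment> \<open>The Neumann series for the inverse of \<open>1 - r\<close>, in fixed-point form;
    solved within \<open>central_selfadjoint\<close>, it yields an inverse that is again central and
    symmetric.\<close>
  have "\<exists>!u. u \<in> central_selfadjoint \<and> id_blinfun + (r o\<^sub>L u) = u"
  proof (rule Banach_fix[OF _ _ q])
    show "complete central_selfadjoint" by (simp add: complete_eq_closed closed_central_selfadjoint)
    show "central_selfadjoint \<noteq> {}" using r by blast
    show "(\<lambda>u. id_blinfun + (r o\<^sub>L u)) ` central_selfadjoint \<subseteq> central_selfadjoint"
      by (auto intro!: central_selfadjoint_closed r)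
    fix u u' :: "'g \<Rightarrow>\<^sub>L 'g"
    have "id_blinfun + (r o\<^sub>L u) - (id_blinfun + (r o\<^sub>L u')) = r o\<^sub>L (u - u')"
      by (simp add: blinfun_eq_iff blinfun.add_left blinfun.diff_left blinfun.diff_right)
    then show "dist (id_blinfun + (r o\<^sub>L u)) (id_blinfun + (r o\<^sub>L u')) \<le> q * dist u u'"
      unfolding dist_norm
      by (simp only:) (intro order_trans[OF norm_blinfun_compose] mult_right_mono r norm_ge_zero)
  qed
  from ex1_implies_ex[OF this]
  obtain u where u: "u \<in> central_selfadjoint" and fix_u: "id_blinfun + (r o\<^sub>L u) = u"
    by auto
  have ru: "r (u g) = u g - g" for g
    by (subst (2) fix_u[symmetric]) (simp add: blinfun.add_left)
  have ur: "u (r g) = u g - g" for g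
    using central_selfadjointD(2)[OF u central_selfadjointD(1)[OF r(1)]] ru by simp
  have pg: "p g = K *\<^sub>R (g - r g - r (g - r g))" for g
  proof -
    have "a + (r o\<^sub>L r) = 2 *\<^sub>R r" by (subst (3) fix_r[symmetric]) simp
    then have "blinfun_apply (a + (r o\<^sub>L r)) g = blinfun_apply (2 *\<^sub>R r) g" by simp
    then have "(1 / K) *\<^sub>R p g = g - r g - r (g - r g)"
      by (simp add: a_def blinfun.add_left blinfun.diff_left blinfun.scaleR_left blinfun.diff_right
          scaleR_2 algebra_simps)
    then have "K *\<^sub>R (1 / K) *\<^sub>R p g = K *\<^sub>R (g - r g - r (g - r g))" by simp
    then show ?thesis using K by simp
  qed
  show thesis
  proof
    \<comment> \<open>As \<open>u\<close> inverts \<open>1 - r\<close> and \<open>p\<close> is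
      \<open>K\<close> times the square of \<open>1 - r\<close>, the product \<open>u p u\<close> is
      \<open>K\<close>; each of the two outer factors takes one \<open>1 / sqrt K\<close>.\<close>
    show "(1 / sqrt K) *\<^sub>R u \<in> central_selfadjoint" by (rule central_selfadjoint_closed(2)[OF u])
    have "u (p (u g)) = K *\<^sub>R g" for g
      unfolding pg by (simp add: blinfun.scaleR_right ru ur blinfun.diff_right)
    then show "(1 / sqrt K) *\<^sub>R u o\<^sub>L p o\<^sub>L (1 / sqrt K) *\<^sub>R u = id_blinfun"
      using K by (simp add: blinfun_eq_iff blinfun.scaleR_left blinfun.scaleR_right)
  qed
qed

end

section \<open>Splitting off the algebra\<close>

context vn_bimodule
begin

text \<open>Because \<open>y\<close> has inner square 1, \<open>w \<mapsto> y <y, w>\<close> is a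
  projection with range \<open>y B\<close>; because \<open>y\<close> commutes with \<open>B\<close>,
  this projection and its complement respect both actions. The complement keeps the ambient space
  and the embedding \<open>L\<close> of \<open>E\<close>.\<close>

lemma orthogonal_complement_splitting:
  assumes y: "y \<in> carrier E" and one: "ip E y y = id_blinfun"
    and central: "\<And>b. b \<in> B \<Longrightarrow> lact E b y = ract E y b"
  shows "\<exists>F :: ('e, 'g \<Rightarrow>\<^sub>L 'g, 'g \<Rightarrow>\<^sub>L 'g) bimodule.
    von_neumann_bimodule TYPE('h) B B F \<and> isomorphic B B E (direct_sum (self_bimodule B) F)"
proof (intro exI conjI)
  define F where "F = E\<lparr>carrier := {w \<in> carrier E. ip E y w = 0}\<rparr>"
  have F: "carrier F = {w \<in> carrier E. ip E y w = 0}"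
    "lact F = lact E" "ract F = ract E" "ip F = ip E" "mod_norm F = mod_norm E"
    by (simp_all add: F_def mod_norm_def fun_eq_iff)
  have ip_lact: "ip E y (lact E b w) = b o\<^sub>L ip E y w" if "b \<in> B" "w \<in> carrier E" for b w
    using lact_adj[OF alg.adj_closed[OF that(1)] y that(2)]
    by (simp add: central alg.adj_closed alg.adj_involution that ip_ract_left y)
  note compose_zero = bounded_bilinear.zero_left[OF bounded_bilinear_blinfun_compose]
    bounded_bilinear.zero_right[OF bounded_bilinear_blinfun_compose]
  have complete_F: "\<exists>u\<in>carrier F. (\<lambda>n. mod_norm F (s n - u)) \<longlonglongrightarrow> 0"
    if s: "\<And>n. s n \<in> carrier F"
      and Cauchy: "\<forall>e>0. \<exists>N. \<forall>m\<ge>N. \<forall>n\<ge>N. mod_norm F (s m - s n) < e" for s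
  proof -
    have sE: "s n \<in> carrier E" and s_perp: "ip E y (s n) = 0" for n using s[of n] by (simp_all add: F)
    obtain u where u: "u \<in> carrier E" and lim: "(\<lambda>n. mod_norm E (s n - u)) \<longlonglongrightarrow> 0"
      using complete[of s, OF sE] Cauchy by (auto simp: F)
    have "norm (ip E y u) \<le> norm (L y) * mod_norm E (s n - u)" for n
      using norm_ip_le[OF y diff_closed[OF sE u], of n]
      by (simp add: ip_diff_right y sE u s_perp mod_norm_eq diff_closed)
    moreover have "(\<lambda>n. norm (L y) * mod_norm E (s n - u)) \<longlonglongrightarrow> norm (L y) * 0"
      by (intro tendsto_intros lim)
    ultimately have "norm (ip E y u) \<le> norm (L y) * 0"
      by (intro LIMSEQ_le_const) auto
    then show ?thesis using u lim by (auto simp: F)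
  qed
  have module_F: "hilbert_module B F"
  proof (rule hilbert_module.intro, goal_cases)
    case (15 v w) then show ?case using ip_adj[of v w] by (simp add: F)
  next
    case (18 s) then show ?case by (rule complete_F)
  qed (simp_all add: F y compose_zero zero_closed add_closed scaleC_closed ract_closed ract_add_left
      ract_add_right ract_scaleC_left ract_scaleC_right ract_compose ract_one ip_closed ip_add_right
      ip_scaleC_right ip_ract_right ip_positive ip_definite ip_zero_right)
  have bimodule_F: "hilbert_bimodule B B F"
    by (intro hilbert_bimodule.intro module_F hilbert_bimodule_axioms.intro)
      (simp_all add: F lact_closed ip_lact compose_zero lact_adj lact_add lact_scaleC lact_compose
        lact_one)
  have "tensor_embedding F L" using embedding by (simp add: tensor_embedding_def F)
  moreover have "closedin (subtopology strong_operator_topology (ops_into (tensor_space F L)))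
      (L ` carrier F)"
  proof -
    obtain C where C: "closedin strong_operator_topology C"
      "L ` carrier E = C \<inter> ops_into (tensor_space E L)"
      using strongly_closed by (auto simp: closedin_subtopology)
    have F_sub: "L ` carrier F \<subseteq> ops_into (tensor_space F L)"
    proof
      fix T assume "T \<in> L ` carrier F"
      then obtain w where w: "w \<in> carrier F" "T = L w" by blast
      have "L w g \<in> span {L x g | x g. x \<in> carrier F}" for g
        by (rule span_base) (use w in blast)
      then have "range (L w) \<subseteq> tensor_space F L"
        unfolding tensor_space_def using closure_subset by blast
      moreover have "clinear_op (L w)" using w by (simp add: F clinear_L)
      ultimately show "T \<in> ops_into (tensor_space F L)" by (simp add: ops_into_def w(2))
    qed
    have F_E: "carrier F \<subseteq> carrier E" by (auto simp: F)
    then have "tensor_space F L \<subseteq> tensor_space E L"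
      unfolding tensor_space_def by (intro closure_mono span_mono) blast
    then have ops: "ops_into (tensor_space F L) \<subseteq> ops_into (tensor_space E L)"
      by (auto simp: ops_into_def)
    \<comment> \<open>Passing to \<open>F\<close> also shrinks the tensor space. If
      \<open>L w\<close> takes values in the smaller space, it is orthogonal to all
      \<open>L y f\<close>, which forces \<open>w\<close> into \<open>F\<close>; so the closed set
      \<open>C\<close> obtained for \<open>E\<close> serves \<open>F\<close> too.\<close>
    have in_F: "w \<in> carrier F" if w: "w \<in> carrier E" "L w \<in> ops_into (tensor_space F L)" for w
    proof -
      have "ip E y w = 0"
      proof (rule blinfun_eq_cinnerI)
        fix f g
        have "L w g \<in> closure (span {L x g | x g. x \<in> carrier F})"
          using w(2) by (auto simp: ops_into_def tensor_space_def)
        then have "cinner (L y f) (L w g) = 0"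
          by (rule cinner_closure_span_eq_zero) (auto simp: F cinner_L y)
        then show "cinner f (ip E y w g) = cinner f (blinfun_apply 0 g)" by (simp add: cinner_L y w)
      qed
      then show ?thesis by (simp add: F w)
    qed
    have "L ` carrier F = C \<inter> ops_into (tensor_space F L)"
    proof (intro equalityI subsetI IntI)
      fix T assume "T \<in> C \<inter> ops_into (tensor_space F L)"
      then have T: "T \<in> ops_into (tensor_space F L)" and "T \<in> L ` carrier E" using C(2) ops by auto
      then obtain w where "w \<in> carrier E" "T = L w" by blast
      then show "T \<in> L ` carrier F" using in_F T by blast
    next
      fix T assume T: "T \<in> L ` carrier F"
      then have "T \<in> L ` carrier E" using F_E by blast
      then show "T \<in> C" using C(2) by blast
      show "T \<in> ops_into (tensor_space F L)" using T F_sub by blast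
    qed
    with C(1) show ?thesis unfolding closedin_subtopology by blast
  qed
  ultimately show "von_neumann_bimodule TYPE('h) B B F"
    unfolding von_neumann_bimodule_def von_neumann_module_def using bimodule_F module_F by blast
  define u where "u w = (ip E y w, w - ract E y (ip E y w))" for w
  have yw: "ract E y (ip E y w) \<in> carrier E" if "w \<in> carrier E" for w
    by (simp add: ract_closed ip_closed y that)
  have snd_closed: "w - ract E y (ip E y w) \<in> carrier F" if "w \<in> carrier E" for w
    by (simp add: F diff_closed yw that ip_diff_right y ip_ract_right ip_closed one)
  have "bimodule_iso B B E (direct_sum (self_bimodule B) F) u"
    unfolding bimodule_iso_def
  proof (intro conjI ballI allI)
    show "bij_betw u (carrier E) (carrier (direct_sum (self_bimodule B) F))"
    proof (rule bij_betwI[where g = "\<lambda>(b, v). ract E y b + v"])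
      show "u \<in> carrier E \<rightarrow> carrier (direct_sum (self_bimodule B) F)"
        using snd_closed by (auto simp: direct_sum_def self_bimodule_def u_def ip_closed y)
      show "(\<lambda>(b, v). ract E y b + v) \<in> carrier (direct_sum (self_bimodule B) F) \<rightarrow> carrier E"
        by (auto simp: direct_sum_def self_bimodule_def F add_closed ract_closed y)
      show "(\<lambda>(b, v). ract E y b + v) (u w) = w" for w by (simp add: u_def)
      show "u ((\<lambda>(b, v). ract E y b + v) p) = p"
        if "p \<in> carrier (direct_sum (self_bimodule B) F)" for p
        using that
        by (auto simp: direct_sum_def self_bimodule_def F u_def ip_add_right y ract_closed
            ip_ract_right one)
    qed
    fix w assume w: "w \<in> carrier E"
    show "u (c *\<^sub>C w) = c *\<^sub>C u w" for c
      by (simp add: u_def scaleC_prod_def ip_scaleC_right y w ract_scaleC_right ip_closed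
          scaleC_diff_right)
    show "u (ract E w b) = ract (direct_sum (self_bimodule B) F) (u w) b" if b: "b \<in> B" for b
    proof -
      have "ract E (w - ract E y (ip E y w)) b = ract E w b - ract E (ract E y (ip E y w)) b"
        using ract_add_left[OF diff_closed[OF w yw[OF w]] yw[OF w] b] by (simp add: eq_diff_eq)
      then show ?thesis
        by (simp add: u_def direct_sum_def self_bimodule_def F ip_ract_right y w b ract_compose
            ip_closed)
    qed
    show "u (lact E a w) = lact (direct_sum (self_bimodule B) F) a (u w)" if a: "a \<in> B" for a
    proof -
      \<comment> \<open>By centrality \<open>y b\<close> is \<open>b y\<close>, so \<open>a\<close>
        simply multiplies in the algebra.\<close>
      have "lact E a (ract E y (ip E y w)) = ract E y (a o\<^sub>L ip E y w)"
        by (simp add: central[symmetric] lact_compose a ip_closed y w alg.compose_closed)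
      moreover have "lact E a (w - ract E y (ip E y w))
          = lact E a w - lact E a (ract E y (ip E y w))"
        using lact_add_right[OF a diff_closed[OF w yw[OF w]] yw[OF w]] by (simp add: eq_diff_eq)
      ultimately show ?thesis
        by (simp add: u_def direct_sum_def self_bimodule_def F ip_lact w a)
    qed
    fix w' assume w': "w' \<in> carrier E"
    show "u (w + w') = u w + u w'"
      by (simp add: u_def ip_add_right y w w' ract_add_right ip_closed)
    show "ip (direct_sum (self_bimodule B) F) (u w) (u w') = ip E w w'"
    proof -
      have "ip E w (ract E y (ip E y w')) = adj (ip E y w) o\<^sub>L ip E y w'"
        using ip_adj[OF w y] by (simp add: ip_ract_right w w' y ip_closed)
      then show ?thesis
        by (simp add: u_def direct_sum_def self_bimodule_def F ip_diff_left ip_diff_right w w' y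
            yw diff_closed ip_ract_left ip_ract_right ip_closed one blinfun_eq_iff
            blinfun.add_left blinfun.diff_left blinfun.diff_right)
    qed
  qed
  then show "isomorphic B B E (direct_sum (self_bimodule B) F)"
    unfolding isomorphic_def by blast
qed

end

section \<open>Transfer from the common module to \<open>E\<close>\<close>

theorem theorem4p0p2:
  fixes B :: "('g::complex_hilbert_space \<Rightarrow>\<^sub>L 'g) set"
    and \<phi> :: "'g \<Rightarrow>\<^sub>L 'g \<Rightarrow> 'g \<Rightarrow>\<^sub>L 'g"
    and E :: "('e::complex_vector, 'g \<Rightarrow>\<^sub>L 'g, 'g \<Rightarrow>\<^sub>L 'g) bimodule"
    and x :: 'e
  assumes "von_neumann_algebra B"
    and "completely_positive B B \<phi>"
    and "bures_distance TYPE('m::complex_vector) B B id \<phi> < 1"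
    and "gns_construction TYPE('h::complex_hilbert_space) B \<phi> E x"
  shows "\<exists>F :: ('e, 'g \<Rightarrow>\<^sub>L 'g, 'g \<Rightarrow>\<^sub>L 'g) bimodule.
    von_neumann_bimodule TYPE('h) B B F \<and> isomorphic B B E (direct_sum (self_bimodule B) F)"
proof -
  interpret alg: vn_algebra B by unfold_locales (rule assms)
  obtain M :: "('m, 'g \<Rightarrow>\<^sub>L 'g, 'g \<Rightarrow>\<^sub>L 'g) bimodule" and x\<^sub>1 x\<^sub>2 where
    M: "common_rep_module B B M id \<phi>" and S: "x\<^sub>1 \<in> S_set B M id" "x\<^sub>2 \<in> S_set B M \<phi>"
    and dist: "mod_norm M (x\<^sub>1 - x\<^sub>2) < 1"
    using assms(3) unfolding bures_distance_def bures_distance_on_def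
    by (auto simp: INF_less_iff one_ereal_def)
  interpret M: hilbert_bimodule B B M using M by (simp add: common_rep_module_def)
  interpret M: vn_correspondence B M by unfold_locales
  have x\<^sub>1: "x\<^sub>1 \<in> carrier M" "\<And>a. a \<in> B \<Longrightarrow> ip M x\<^sub>1 (lact M a x\<^sub>1) = a"
    and x\<^sub>2: "x\<^sub>2 \<in> carrier M" "\<And>a. a \<in> B \<Longrightarrow> ip M x\<^sub>2 (lact M a x\<^sub>2) = \<phi> a"
    using S by (auto simp: S_set_def)
  have bim_E: "hilbert_bimodule B B E" and x: "x \<in> carrier E"
    and \<phi>: "\<And>b. b \<in> B \<Longrightarrow> \<phi> b = ip E x (lact E b x)"
    using assms(4) by (auto simp: gns_construction_def von_neumann_bimodule_def)
  obtain L :: "'e \<Rightarrow> 'g \<Rightarrow>\<^sub>L 'h" where L: "tensor_embedding E L"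
    "closedin (subtopology strong_operator_topology (ops_into (tensor_space E L))) (L ` carrier E)"
    using assms(4) by (auto simp: gns_construction_def von_neumann_bimodule_def von_neumann_module_def)
  interpret hilbert_bimodule B B E by (rule bim_E)
  interpret vn_bimodule B E L by unfold_locales (rule L)+
  define c where "c = ip M x\<^sub>1 x\<^sub>2"
  define \<delta> where "\<delta> = 1 - mod_norm M (x\<^sub>1 - x\<^sub>2)"
  have c: "c \<in> B" by (simp add: c_def M.ip_closed x\<^sub>1 x\<^sub>2)
  have one: "ip M x\<^sub>1 x\<^sub>1 = id_blinfun" using x\<^sub>1(2)[OF alg.one_closed] by (simp add: M.lact_one x\<^sub>1)
  have \<delta>: "\<delta> > 0" using dist by (simp add: \<delta>_def)
  have c_near: "norm (id_blinfun - c) \<le> 1 - \<delta>"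
    using M.norm_ip_le_mod_norm[OF x\<^sub>1(1) M.diff_closed[OF x\<^sub>1(1) x\<^sub>2(1)] one]
    by (simp add: M.ip_diff_right x\<^sub>1(1) x\<^sub>2(1) one c_def \<delta>_def)
  have dom: "norm (\<Sum>i<n::nat. blinfun_apply (a i) (c (f i))) \<le> norm (\<Sum>i<n. L (lact E (a i) x) (f i))"
    if a: "\<And>i. i < n \<Longrightarrow> a i \<in> B" for n a f
  proof (rule power2_le_imp_le)
    have "(norm (\<Sum>i<n. blinfun_apply (a i) (c (f i))))\<^sup>2
        \<le> Re (\<Sum>i<n. \<Sum>j<n. cinner (f i) (ip M x\<^sub>2 (lact M (adj (a i) o\<^sub>L a j) x\<^sub>2) (f j)))"
      unfolding c_def using a by (intro M.gram_dominates[OF x\<^sub>1 x\<^sub>2(1)]) auto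
    \<comment> \<open>The passage from \<open>M\<close> to \<open>E\<close>: the same value of
      \<phi> is read once through \<open>x\<^sub>2\<close> and once through
      \<open>x\<close>.\<close>
    also have "(\<Sum>i<n. \<Sum>j<n. cinner (f i) (ip M x\<^sub>2 (lact M (adj (a i) o\<^sub>L a j) x\<^sub>2) (f j)))
        = (\<Sum>i<n. \<Sum>j<n. cinner (L (lact E (a i) x) (f i)) (L (lact E (a j) x) (f j)))"
      by (intro sum.cong refl)
        (simp add: a x\<^sub>2(2) \<phi> alg.compose_closed alg.adj_closed cinner_L lact_closed x ip_lact_lact)
    also have "Re \<dots> = (norm (\<Sum>i<n. L (lact E (a i) x) (f i)))\<^sup>2"
      unfolding Re_cinner_self[symmetric] cinner_sum_left cinner_sum_right
      by (rule arg_cong[OF sum.swap])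
    finally show "(norm (\<Sum>i<n. blinfun_apply (a i) (c (f i))))\<^sup>2
        \<le> (norm (\<Sum>i<n. L (lact E (a i) x) (f i)))\<^sup>2" .
  qed simp
  obtain z where z: "z \<in> carrier E" and xz: "ip E x z = adj c"
    and z_central: "\<And>b. b \<in> B \<Longrightarrow> lact E b z = ract E z b"
    using central_vector_exists[OF x c dom] by blast
  define p where "p = ip E z z"
  have p: "p \<in> alg.central_selfadjoint"
  proof (rule alg.central_selfadjointI)
    \<comment> \<open>\<open>p b\<close> is <z, z b> = <z, b z>, which is
      \<open>b p\<close>.\<close>
    show "p o\<^sub>L b = b o\<^sub>L p" if "b \<in> B" for b
      using ip_central_lact[OF z z_central that z]
      by (simp add: z_central that ip_ract_right z p_def)
  qed (simp_all add: p_def ip_closed z cinner_ip)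
  \<comment> \<open>Solving \<open>\<delta> * (norm g)\<^sup>2 \<le> norm (L x g) * norm (L z
    g)\<close> for the last factor and squaring gives this constant; adding 1 keeps the denominator
    positive.\<close>
  define \<epsilon> where "\<epsilon> = (\<delta> / (norm (L x) + 1))\<^sup>2"
  have Lx: "norm (L x) + 1 > 0" by (simp add: add_nonneg_pos)
  have lower: "\<epsilon> * (norm g)\<^sup>2 \<le> Re (cinner g (p g))" for g
  proof -
    have "\<delta> * (norm g)\<^sup>2 \<le> Re (cinner (c g) g)"
    proof -
      have "(norm g)\<^sup>2 - Re (cinner (c g) g) = Re (cinner ((id_blinfun - c) g) g)"
        by (simp add: blinfun.diff_left cinner_diff_left Re_cinner_self)
      also have "\<dots> \<le> norm ((id_blinfun - c) g) * norm g"
        by (intro order_trans[OF complex_Re_le_cmod] cinner_Cauchy_Schwarz)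
      also have "\<dots> \<le> ((1 - \<delta>) * norm g) * norm g"
        by (intro mult_right_mono order_trans[OF norm_blinfun] c_near) auto
      finally show ?thesis by (simp add: power2_eq_square algebra_simps)
    qed
    also have "cinner (c g) g = cinner (L x g) (L z g)"
      by (simp add: cinner_L x z xz alg.adj_right c)
    also have "Re \<dots> \<le> norm (L x g) * norm (L z g)"
      by (intro order_trans[OF complex_Re_le_cmod] cinner_Cauchy_Schwarz)
    also have "\<dots> \<le> ((norm (L x) + 1) * norm g) * norm (L z g)"
      by (intro mult_right_mono order_trans[OF norm_blinfun]) auto
    finally have "norm g * (\<delta> * norm g) \<le> norm g * ((norm (L x) + 1) * norm (L z g))"
      by (simp add: power2_eq_square algebra_simps)
    then have "\<delta> * norm g \<le> (norm (L x) + 1) * norm (L z g)"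
      using Lx by (cases "g = 0") auto
    then have "\<delta> / (norm (L x) + 1) * norm g \<le> norm (L z g)"
      using Lx by (simp add: field_simps)
    then have "(\<delta> / (norm (L x) + 1) * norm g)\<^sup>2 \<le> (norm (L z g))\<^sup>2"
      by (rule power_mono) (use \<delta> Lx in simp)
    moreover have "(norm (L z g))\<^sup>2 = Re (cinner g (p g))"
      by (simp add: p_def cinner_L z flip: Re_cinner_self)
    ultimately show ?thesis by (simp add: \<epsilon>_def power_mult_distrib power_divide)
  qed
  have "\<epsilon> > 0" using \<delta> Lx by (simp add: \<epsilon>_def)
  from alg.inverse_square_root[OF p lower this]
  obtain s where s: "s \<in> alg.central_selfadjoint" and sps: "s o\<^sub>L p o\<^sub>L s = id_blinfun" by blast
  have sB: "s \<in> B" by (rule alg.central_selfadjointD(1)[OF s])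
  have adj_s: "adj s = s" by (rule adjoint_unique) (rule alg.central_selfadjointD(3)[OF s])
  show ?thesis
  proof (rule orthogonal_complement_splitting)
    show zs: "ract E z s \<in> carrier E" by (simp add: ract_closed z sB)
    have "ip E (ract E z s) (ract E z s) = s o\<^sub>L p o\<^sub>L s"
      by (simp add: ip_ract_left ip_ract_right z sB zs adj_s p_def)
    then show "ip E (ract E z s) (ract E z s) = id_blinfun" using sps by simp
    \<comment> \<open>Writing \<open>z s\<close> as \<open>s z\<close> turns everything into actions
      on \<open>z\<close>: \<open>b s z = z b s = z s b\<close>. No right linearity of the left
      action is invoked.\<close>
    show "lact E b (ract E z s) = ract E (ract E z s) b" if b: "b \<in> B" for b
    proof -
      have "b o\<^sub>L s = s o\<^sub>L b" using alg.central_selfadjointD(2)[OF s b] by (simp add: blinfun_eq_iff)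
      then show ?thesis
        using ract_compose[OF z b sB] ract_compose[OF z sB b] lact_compose[OF b sB z]
          lact_compose[OF sB b z] z_central[OF b] z_central[OF sB]
          z_central[OF alg.compose_closed[OF b sB]]
        by simp
    qed
  qed
qed

end
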